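(* Let $I=(S,\{t\},(\infty,\infty,\infty),0)$ be a convex instance of FLaMECaST (one intermediate layer, a single sink $t$, unlimited capacities, $\alpha=0$). Then there is a linear order on $S$, obtained from the cyclic ordering of the sources by choosing a starting source, and a minimum-cost layout $L$ of $I$ such that $L$ is $3$-consecutive with respect to this linear order.
   Context: FLaMECaST: an instance $I=(S,T,C,\alpha)$ consists of a finite set $S$ of sources and a finite set $T$ of sinks, each with a fixed position in $\mathbb{R}^2$ (several sources may share a position), capacities $C=(c_0,\dots,c_{\lambda+1})$ ($\lambda$ = number of intermediate layers; here $\lambda=1$ and all capacities are $\infty$, i.e., no capacity constraints), and $\alpha\in[0,1]$. A layout consists of a rooted forest (edges directed from child to parent) of height at most $\lambda+1$ whose leaves are exactly $S$ and whose roots lie in $T$ (other vertices are Steiner vertices), together with an embedding mapping sources and sinks to their positions and Steiner vertices to arbitrary points of $\mathbb{R}^2$. The cost of an edge $uv$ ($u$ child of $v$) is $\|\mathrm{pos}(u)-\mathrm{pos}(v)\|\cdot\ell(uv)^\alpha$, where $\ell(uv)$ is the number of sources in the subtree of $u$; for $\alpha=0$ this is the edge length. The cost of a layout is the sum of its edge costs. An instance is convex if all sources lie on the boundary of the convex hull of $S\cup T$; the cyclic ordering of the sources is the counterclockwise order along this boundary. A Steiner vertex is $k$-consecutive with respect to a linear order if its children can be partitioned into at most $k$ sequences of sources that are consecutive in that order; a layout is $k$-consecutive if all its Steiner vertices are. *)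

theory Defs
  imports "HOL-Analysis.Analysis" "HOL-Library.Sublist" "HOL-Library.Disjoint_Sets"
begin

section \<open>Instances and layouts\<close>

text \<open>
  Only instances without capacity constraints (all capacities \<open>\<infinity>\<close>) are modelled, so the
  capacities are not recorded; \<open>layers\<close> is the number \<open>\<lambda>\<close> of intermediate layers.
  Distinct sources may have the same position.
\<close>

record ('s, 't) flamecast =
  sources :: "'s set"
  sinks :: "'t set"
  source_pos :: "'s \<Rightarrow> real^2"
  sink_pos :: "'t \<Rightarrow> real^2"
  layers :: nat
  alpha :: real

definition flamecast :: "('s, 't) flamecast \<Rightarrow> bool" where
  "flamecast I \<longleftrightarrow> finite (sources I) \<and> finite (sinks I) \<and> 0 \<le> alpha I \<and> alpha I \<le> 1"

datatype ('s, 't) vertex = Source 's | Sink 't | Steiner nat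

record ('s, 't) layout =
  verts :: "('s, 't) vertex set"
  edges :: "(('s, 't) vertex \<times> ('s, 't) vertex) set"
  pos :: "('s, 't) vertex \<Rightarrow> real^2"

definition rooted_forest :: "'v set \<Rightarrow> ('v \<times> 'v) set \<Rightarrow> bool" where
  "rooted_forest V E \<longleftrightarrow> finite V \<and> E \<subseteq> V \<times> V \<and> single_valued E \<and> acyclic E"

definition leaves :: "'v set \<Rightarrow> ('v \<times> 'v) set \<Rightarrow> 'v set" where
  "leaves V E = V - Range E"

definition roots :: "'v set \<Rightarrow> ('v \<times> 'v) set \<Rightarrow> 'v set" where
  "roots V E = V - Domain E"

text \<open>\<open>E ^^ Suc h = {}\<close> says that no directed path has more than \<open>h\<close> edges.\<close>

definition height_at_most :: "nat \<Rightarrow> ('v \<times> 'v) set \<Rightarrow> bool" where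
  "height_at_most h E \<longleftrightarrow> E ^^ Suc h = {}"

definition is_layout :: "('s, 't) flamecast \<Rightarrow> ('s, 't) layout \<Rightarrow> bool" where
  "is_layout I L \<longleftrightarrow>
     rooted_forest (verts L) (edges L) \<and>
     height_at_most (layers I + 1) (edges L) \<and>
     leaves (verts L) (edges L) = Source ` sources I \<and>
     roots (verts L) (edges L) \<subseteq> Sink ` sinks I \<and>
     verts L - leaves (verts L) (edges L) - roots (verts L) (edges L) \<subseteq> range Steiner \<and>
     (\<forall>s\<in>sources I. pos L (Source s) = source_pos I s) \<and>
     (\<forall>t\<in>sinks I. pos L (Sink t) = sink_pos I t)"

definition load :: "('s, 't) flamecast \<Rightarrow> ('s, 't) layout \<Rightarrow> ('s, 't) vertex \<Rightarrow> nat" where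
  "load I L u = card {s \<in> sources I. (Source s, u) \<in> (edges L)\<^sup>*}"

definition layout_cost :: "('s, 't) flamecast \<Rightarrow> ('s, 't) layout \<Rightarrow> real" where
  "layout_cost I L =
     (\<Sum>(u, v)\<in>edges L. norm (pos L u - pos L v) * real (load I L u) powr alpha I)"

definition min_cost_layout :: "('s, 't) flamecast \<Rightarrow> ('s, 't) layout \<Rightarrow> bool" where
  "min_cost_layout I L \<longleftrightarrow>
     is_layout I L \<and> (\<forall>L'. is_layout I L' \<longrightarrow> layout_cost I L \<le> layout_cost I L')"

section \<open>Consecutive layouts\<close>

text \<open>A linear order on the sources is given by the list enumerating them.\<close>

definition children :: "('s, 't) layout \<Rightarrow> ('s, 't) vertex \<Rightarrow> ('s, 't) vertex set" where
  "children L v = {u. (u, v) \<in> edges L}"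

definition vertex_consecutive ::
    "nat \<Rightarrow> 's list \<Rightarrow> ('s, 't) layout \<Rightarrow> ('s, 't) vertex \<Rightarrow> bool" where
  "vertex_consecutive k xs L v \<longleftrightarrow>
     (\<exists>P. partition_on (children L v) P \<and> finite P \<and> card P \<le> k \<and>
          (\<forall>B\<in>P. \<exists>ys. sublist ys xs \<and> B = Source ` set ys))"

definition layout_consecutive :: "nat \<Rightarrow> 's list \<Rightarrow> ('s, 't) layout \<Rightarrow> bool" where
  "layout_consecutive k xs L \<longleftrightarrow>
     (\<forall>v \<in> verts L \<inter> range Steiner. vertex_consecutive k xs L v)"

section \<open>Convex instances and the cyclic ordering of the sources\<close>

definition instance_hull :: "('s, 't) flamecast \<Rightarrow> (real^2) set" where
  "instance_hull I = convex hull (source_pos I ` sources I \<union> sink_pos I ` sinks I)"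

definition convex_instance :: "('s, 't) flamecast \<Rightarrow> bool" where
  "convex_instance I \<longleftrightarrow> source_pos I ` sources I \<subseteq> frontier (instance_hull I)"

text \<open>Nonnegative iff \<open>c\<close> does not lie strictly to the right of the directed line from \<open>a\<close> to \<open>b\<close>.\<close>

definition orient :: "real^2 \<Rightarrow> real^2 \<Rightarrow> real^2 \<Rightarrow> real" where
  "orient a b c = (b $ 1 - a $ 1) * (c $ 2 - a $ 2) - (b $ 2 - a $ 2) * (c $ 1 - a $ 1)"

text \<open>
  \<open>vs\<close> lists the corners of the convex polygon \<open>H\<close> in counterclockwise order: \<open>H\<close> lies to the
  left of every edge. If \<open>H\<close> is a segment, then \<open>vs\<close> consists of its two endpoints and the
  boundary is traversed there and back.
\<close>

definition ccw_corners :: "(real^2) set \<Rightarrow> (real^2) list \<Rightarrow> bool" where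
  "ccw_corners H vs \<longleftrightarrow> distinct vs \<and> set vs = {x. x extreme_point_of H} \<and>
     (\<forall>i<length vs. \<forall>x\<in>H. 0 \<le> orient (vs ! i) (vs ! (Suc i mod length vs)) x)"

text \<open>
  The closed polygonal walk through \<open>vs\<close>, at \<open>vs ! i\<close> at time \<open>i\<close>; the parameter ranges over
  \<open>{0..<length vs}\<close>.
\<close>

definition boundary_walk :: "(real^2) list \<Rightarrow> real \<Rightarrow> real^2" where
  "boundary_walk vs \<tau> = (let i = nat \<lfloor>\<tau>\<rfloor> in
     (1 - frac \<tau>) *\<^sub>R vs ! i + frac \<tau> *\<^sub>R vs ! (Suc i mod length vs))"

text \<open>
  \<open>xs\<close> lists the sources as met by one counterclockwise walk along the boundary of the hull that
  starts at some corner; it is to be read cyclically, i.e. it represents the cyclic ordering, whose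
  linear versions are the lists \<open>rotate k xs\<close>. Sources with the same position come in any order;
  if the hull is a segment, a source may be met on the way there or on the way back.
\<close>

definition ccw_source_order :: "('s, 't) flamecast \<Rightarrow> 's list \<Rightarrow> bool" where
  "ccw_source_order I xs \<longleftrightarrow> distinct xs \<and> set xs = sources I \<and>
     (\<exists>vs \<tau>. ccw_corners (instance_hull I) vs \<and>
        (\<forall>s\<in>sources I. \<tau> s \<in> {0..<real (length vs)} \<and> boundary_walk vs (\<tau> s) = source_pos I s) \<and>
        sorted (map \<tau> xs))"

subsection \<open>Existence of the cyclic ordering\<close>

lemma orient_convex:
  assumes "\<forall>x\<in>X. 0 \<le> orient a b x" and "x \<in> convex hull X"
  shows "0 \<le> orient a b x"
proof -
  have "convex {x. 0 \<le> orient a b x}"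
  proof -
    define w :: "real^2" where "w = vector [- (b $ 2 - a $ 2), b $ 1 - a $ 1]"
    have "orient a b x = w \<bullet> x - w \<bullet> a" for x
      by (simp add: orient_def w_def inner_vec_def sum_2 algebra_simps)
    then have "{x. 0 \<le> orient a b x} = {x. w \<bullet> x \<ge> w \<bullet> a}"
      by auto
    then show ?thesis
      by (simp add: convex_halfspace_ge)
  qed
  then show ?thesis
    using assms hull_minimal[of X "{x. 0 \<le> orient a b x}" convex] by blast
qed

lemma in_triangle:
  assumes "orient q b c > 0" "orient a q c \<ge> 0" "orient a b q \<ge> 0"
  shows "q \<in> convex hull {a, b, c}"
proof -
  define D where "D = orient q b c + orient a q c + orient a b q"
  have D: "D > 0" using assms by (simp add: D_def)
  have "D *\<^sub>R q = orient q b c *\<^sub>R a + orient a q c *\<^sub>R b + orient a b q *\<^sub>R c"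
    unfolding D_def by (simp add: vec_eq_iff forall_2 orient_def algebra_simps)
  then have "q = (1 / D) *\<^sub>R (orient q b c *\<^sub>R a + orient a q c *\<^sub>R b + orient a b q *\<^sub>R c)"
    using D by (metis divide_self_if less_irrefl scaleR_one scaleR_scaleR times_divide_eq_left mult_1)
  then have "q = (orient q b c / D) *\<^sub>R a + (orient a q c / D) *\<^sub>R b + (orient a b q / D) *\<^sub>R c"
    by (simp add: scaleR_add_right)
  moreover have "orient q b c / D + orient a q c / D + orient a b q / D = 1"
    using D by (simp add: D_def add_divide_distrib[symmetric])
  moreover have "orient q b c / D \<ge> 0" "orient a q c / D \<ge> 0" "orient a b q / D \<ge> 0"
    using D assms by auto
  ultimately show ?thesis
    unfolding convex_hull_3 by blast
qed

lemma extreme_in_triangle: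
  assumes "q extreme_point_of H" "convex H" "{a, b, c} \<subseteq> H" "q \<in> convex hull {a, b, c}"
  shows "q \<in> {a, b, c}"
proof -
  have "convex hull {a, b, c} \<subseteq> H"
    using assms by (simp add: hull_minimal)
  then have "q extreme_point_of (convex hull {a, b, c})"
    using assms by (metis (no_types, lifting) extreme_point_of_def subsetD)
  then show ?thesis
    by (rule extreme_point_of_convex_hull)
qed

lemma ccw_corners_exists:
  assumes "finite P"
  shows "\<exists>vs. ccw_corners (convex hull P) vs"
proof -
  define H where "H = convex hull P"
  define X where "X = {x. x extreme_point_of H}"
  have convH: "convex H" and HX: "H = convex hull X"
    using assms Krein_Milman_polytope[of P] by (auto simp: H_def X_def)
  have finX: "finite X"
    using assms finite_subset extreme_point_of_convex_hull
    unfolding X_def H_def by (metis mem_Collect_eq subsetI)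
  have XH: "X \<subseteq> H" by (auto simp: X_def extreme_point_of_def)
  show ?thesis
  proof (cases "X = {}")
    case True
    then have "ccw_corners H []"
      by (simp add: ccw_corners_def X_def)
    then show ?thesis unfolding H_def by blast
  next
    case False
    then obtain a where a: "a \<in> X" by blast
    have "polyhedron H"
      unfolding H_def by (simp add: assms polytope_imp_polyhedron polytope_convex_hull)
    moreover have "{a} face_of H"
      using a by (simp add: X_def face_of_singleton)
    ultimately have "{a} exposed_face_of H"
      by (simp add: exposed_face_of_polyhedron)
    then obtain u \<beta> where u: "H \<subseteq> {x. u \<bullet> x \<le> \<beta>}" "{a} = H \<inter> {x. u \<bullet> x = \<beta>}"
      unfolding exposed_face_of_def by blast
    define f where "f x = - (u \<bullet> (x - a))" for x
    define g :: "real^2 \<Rightarrow> real" where "g x = u $ 2 * (x $ 1 - a $ 1) - u $ 1 * (x $ 2 - a $ 2)" for x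
    have fpos: "f x > 0" if "x \<in> H" "x \<noteq> a" for x
    proof -
      have "u \<bullet> a = \<beta>" "u \<bullet> x \<le> \<beta>" "u \<bullet> x \<noteq> \<beta>"
        using u that by auto
      then show ?thesis by (simp add: f_def inner_diff_right)
    qed
    define key where "key x = g x / f x" for x
    define N where "N = (u $ 1)\<^sup>2 + (u $ 2)\<^sup>2"
    have orN: "N * orient a b c = f b * g c - g b * f c" for b c
      by (simp add: N_def orient_def f_def g_def inner_vec_def sum_2 algebra_simps power2_eq_square)
    have le: "0 \<le> orient a b c"
      if "b \<in> X - {a}" "c \<in> X - {a}" "key b \<le> key c" for b c
    proof -
      have fb: "f b > 0" "f c > 0" using fpos that XH by auto
      then have "u \<noteq> 0" by (auto simp: f_def)
      then have N: "N > 0"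
        unfolding N_def by (metis (mono_tags, opaque_lifting) exhaust_2 sum_power2_gt_zero_iff vec_eq_iff zero_index)
      have "g b * f c \<le> g c * f b"
        using that(3) fb by (simp add: key_def field_simps)
      then have "0 \<le> N * orient a b c" by (simp add: orN mult.commute)
      then show ?thesis using N by (simp add: zero_le_mult_iff)
    qed
    obtain bs where bs: "set bs = X - {a}" "distinct bs" "sorted (map key bs)"
    proof -
      obtain l where "set l = X - {a}" "distinct l"
        using finite_distinct_list finX by (metis finite_Diff)
      then show ?thesis
        using that[of "sort_key key l"] by simp
    qed
    define m where "m = length bs"
    have key_mono: "key (bs ! i) \<le> key (bs ! j)" if "i \<le> j" "j < m" for i j
      using bs(3) that by (auto simp: m_def sorted_iff_nth_mono)
    have inX: "bs ! i \<in> X - {a}" if "i < m" for i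
      using bs(1) that m_def nth_mem by blast
    have idx: "\<exists>j<m. c = bs ! j" if "c \<in> X" "c \<noteq> a" for c
    proof -
      have "c \<in> set bs" using that bs(1) by simp
      then show ?thesis by (auto simp: m_def in_set_conv_nth)
    qed
    have le_idx: "0 \<le> orient a (bs ! i) (bs ! j)" if "i \<le> j" "j < m" for i j
      using le[OF inX inX key_mono] that by (meson le_less_trans)
    have dent: "q \<in> {a, b, c}"
      if "q \<in> X" "b \<in> X" "c \<in> X" "orient q b c > 0" "0 \<le> orient a q c" "0 \<le> orient a b q" for q b c
      using extreme_in_triangle[OF _ convH _ in_triangle] that XH a unfolding X_def by blast
    have nth_neq: "bs ! i \<noteq> bs ! j" if "i \<noteq> j" "i < m" "j < m" for i j
      using bs(2) that by (simp add: m_def nth_eq_iff_index_eq)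
    have step: "0 \<le> orient (bs ! i) (bs ! Suc i) c" if im: "Suc i < m" and cX: "c \<in> X" for i c
    proof (cases "c = a")
      case True
      have "orient (bs ! i) (bs ! Suc i) a = orient a (bs ! i) (bs ! Suc i)"
        by (simp add: orient_def algebra_simps)
      then show ?thesis using True le_idx[of i "Suc i"] that by simp
    next
      case False
      then obtain j where j: "j < m" "c = bs ! j"
        using idx cX by blast
      consider "j = i" | "j = Suc i" | "j < i" | "j > Suc i" by linarith
      then show ?thesis
      proof cases
        case 1 then show ?thesis using j by (simp add: orient_def)
      next
        case 2 then show ?thesis using j by (simp add: orient_def)
      next
        case 3
        show ?thesis
        proof (rule ccontr)
          assume "\<not> 0 \<le> orient (bs ! i) (bs ! Suc i) c"
          then have "orient (bs ! i) c (bs ! Suc i) > 0"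
            by (simp add: orient_def algebra_simps)
          moreover have "0 \<le> orient a (bs ! i) (bs ! Suc i)" "0 \<le> orient a c (bs ! i)"
            using le_idx that(1) j 3 by auto
          ultimately have "bs ! i \<in> {a, c, bs ! Suc i}"
            using inX[of i] inX[of "Suc i"] that by (intro dent) auto
          moreover have "bs ! i \<noteq> a" "bs ! i \<noteq> c" "bs ! i \<noteq> bs ! Suc i"
            using inX[of i] nth_neq[of i j] nth_neq[of i "Suc i"] that(1) j 3 by auto
          ultimately show False by blast
        qed
      next
        case 4
        show ?thesis
        proof (rule ccontr)
          assume "\<not> 0 \<le> orient (bs ! i) (bs ! Suc i) c"
          then have "orient (bs ! Suc i) (bs ! i) c > 0"
            by (simp add: orient_def algebra_simps)
          moreover have "0 \<le> orient a (bs ! Suc i) c" "0 \<le> orient a (bs ! i) (bs ! Suc i)"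
            using le_idx that(1) j 4 by auto
          ultimately have "bs ! Suc i \<in> {a, bs ! i, c}"
            using inX[of i] inX[of "Suc i"] that by (intro dent) auto
          moreover have "bs ! Suc i \<noteq> a" "bs ! Suc i \<noteq> c" "bs ! Suc i \<noteq> bs ! i"
            using inX[of "Suc i"] nth_neq[of "Suc i" j] nth_neq[of "Suc i" i] that(1) j 4 by auto
          ultimately show False by blast
        qed
      qed
    qed
    have edge: "0 \<le> orient ((a # bs) ! i) ((a # bs) ! (Suc i mod Suc m)) c"
      if i: "i < Suc m" and c: "c \<in> X" for i c
    proof (cases "c = a \<and> (i = 0 \<or> i = m)")
      case True
      then show ?thesis by (auto simp: orient_def m_def)
    next
      case notA: False
      show ?thesis
      proof (cases i)
        case 0
        show ?thesis
        proof (cases "m = 0")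
          case True then show ?thesis using 0 by (simp add: orient_def)
        next
          case False
          have "c \<noteq> a" using notA 0 by auto
          then obtain j where j: "j < m" "c = bs ! j"
            using idx c by blast
          then show ?thesis
            using le_idx[of 0 j] False 0 by simp
        qed
      next
        case (Suc i')
        show ?thesis
        proof (cases "i = m")
          case True
          have "c \<noteq> a" using notA True by auto
          then obtain j where j: "j < m" "c = bs ! j"
            using idx c by blast
          have m_i: "m - Suc 0 = i'" using True Suc by simp
          have "orient (bs ! i') a c = orient a c (bs ! i')"
            by (simp add: orient_def algebra_simps)
          then show ?thesis
            using le_idx[of j i'] j True Suc m_i by simp
        next
          case False
          then show ?thesis using step[of i' c] Suc i c by simp
        qed
      qed
    qed
    have "ccw_corners H (a # bs)"
      unfolding ccw_corners_def
    proof (intro conjI allI impI ballI)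
      show "distinct (a # bs)" "set (a # bs) = {x. x extreme_point_of H}"
        using bs a by (auto simp: X_def)
      fix i x assume "i < length (a # bs)" "x \<in> H"
      then show "0 \<le> orient ((a # bs) ! i) ((a # bs) ! (Suc i mod length (a # bs))) x"
        using orient_convex[of X "(a # bs) ! i"] edge[of i] HX by (simp add: m_def)
    qed
    then show ?thesis unfolding H_def by blast
  qed
qed

lemma frontier_on_edge:
  assumes "ccw_corners H vs" "compact H" "convex H" "p \<in> frontier H"
  shows "\<exists>i<length vs. p \<in> closed_segment (vs ! i) (vs ! (Suc i mod length vs))"
proof -
  have pH: "p \<in> H" using assms by (metis compact_imp_closed frontier_subset_closed subsetD)
  obtain u where u: "u \<noteq> 0" "\<And>x. x \<in> H \<Longrightarrow> u \<bullet> x \<le> u \<bullet> p"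
  proof -
    have "p \<notin> interior H" using assms by (simp add: frontier_def)
    show ?thesis
    proof (cases "interior H = {}")
      case True
      then obtain u b where ub: "u \<noteq> 0" "H \<subseteq> {x. u \<bullet> x = b}"
        using empty_interior_subset_hyperplane[OF \<open>convex H\<close>] by metis
      have eq: "u \<bullet> x = b" if "x \<in> H" for x using ub(2) that by blast
      have "u \<bullet> x \<le> u \<bullet> p" if "x \<in> H" for x using eq[OF that] eq[OF pH] by simp
      then show ?thesis using that ub(1) by blast
    next
      case False
      then have "p \<notin> rel_interior H"
        using \<open>p \<notin> interior H\<close> by (simp add: interior_rel_interior_gen rel_interior_nonempty_interior)
      moreover have "p \<in> closure H" using pH closure_subset by blast
      ultimately obtain w where w: "w \<noteq> 0" "\<And>y. y \<in> closure H \<Longrightarrow> w \<bullet> p \<le> w \<bullet> y"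
        by (metis supporting_hyperplane_relative_frontier[OF \<open>convex H\<close>])
      then show ?thesis using that[of "- w"] closure_subset[of H] by auto
    qed
  qed
  define F where "F = H \<inter> {x. u \<bullet> x = u \<bullet> p}"
  have faceF: "F face_of H"
    unfolding F_def using u \<open>convex H\<close> by (intro face_of_Int_supporting_hyperplane_le) auto
  have key: "orient a b x * (u \<bullet> u) = (u $ 2 * (b $ 1 - a $ 1) - u $ 1 * (b $ 2 - a $ 2)) * (u \<bullet> (x - p))"
    if "a \<in> F" "b \<in> F" for a b x
  proof -
    have "u \<bullet> (a - p) = 0" "u \<bullet> (b - p) = 0" using that by (auto simp: F_def inner_diff_right)
    then show ?thesis
      unfolding orient_def inner_vec_def sum_2 inner_real_def vector_minus_component by algebra
  qed
  define perp where "perp d = u $ 2 * d $ 1 - u $ 1 * d $ 2" for d :: "real^2"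
  have perp: "(u \<bullet> u) *\<^sub>R (a - b) = perp (a - b) *\<^sub>R vector [u $ 2, - u $ 1]"
    if "a \<in> F" "b \<in> F" for a b
  proof -
    have "u \<bullet> (a - b) = 0" using that by (auto simp: F_def inner_diff_right)
    then show ?thesis
      unfolding vec_eq_iff forall_2 perp_def inner_vec_def sum_2 inner_real_def vector_minus_component
        vector_scaleR_component vector_2 real_scaleR_def by (intro conjI; algebra)
  qed
  have uu: "u \<bullet> u > 0" using u by simp
  have "collinear F"
    unfolding collinear_def
  proof (intro exI ballI)
    fix a b assume "a \<in> F" "b \<in> F"
    then have "(1 / (u \<bullet> u)) *\<^sub>R ((u \<bullet> u) *\<^sub>R (a - b))
        = (1 / (u \<bullet> u)) *\<^sub>R (perp (a - b) *\<^sub>R vector [u $ 2, - u $ 1])"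
      using perp by simp
    then show "a - b = (perp (a - b) / (u \<bullet> u)) *\<^sub>R vector [u $ 2, - u $ 1]"
      using uu by simp
  qed
  have "compact F"
    unfolding F_def by (simp add: assms(2) closed_hyperplane compact_Int_closed)
  moreover have "convex F" using faceF face_of_imp_convex by blast
  moreover have pF: "p \<in> F" using pH by (simp add: F_def)
  ultimately obtain e f where ef: "F = closed_segment e f"
    using compact_convex_collinear_segment \<open>collinear F\<close> by (metis empty_iff)
  have ext: "x extreme_point_of H \<longleftrightarrow> x = e \<or> x = f" if "x \<in> F" for x
    using extreme_point_of_face[OF faceF] that ef extreme_point_of_segment by metis
  have eF: "e \<in> F" "f \<in> F" using ef by auto
  have vs: "set vs = {x. x extreme_point_of H}" "distinct vs"
    "\<And>i x. i < length vs \<Longrightarrow> x \<in> H \<Longrightarrow> 0 \<le> orient (vs ! i) (vs ! (Suc i mod length vs)) x"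
    using assms(1) by (auto simp: ccw_corners_def)
  have main: "\<exists>i<length vs. p \<in> closed_segment (vs ! i) (vs ! (Suc i mod length vs))"
    if F: "F = closed_segment a b" and ab: "a \<noteq> b" "{a, b} = {e, f}" and left: "\<And>x. x \<in> H \<Longrightarrow> 0 \<le> orient a b x"
    for a b
  proof -
    have abF: "a \<in> F" "b \<in> F" using F by auto
    then have "a \<in> set vs" "b \<in> set vs" using ext ab vs(1) by auto
    then obtain i where i: "i < length vs" "vs ! i = a" by (meson in_set_conv_nth)
    define s where "s = vs ! (Suc i mod length vs)"
    have "s \<in> set vs" using i unfolding s_def by (metis length_pos_if_in_set mod_less_divisor nth_mem)
    then have sH: "s \<in> H" "s extreme_point_of H" using vs(1) by (auto simp: extreme_point_of_def)
    have "length vs \<noteq> 1" using \<open>a \<in> set vs\<close> \<open>b \<in> set vs\<close> ab(1)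
      by (cases vs) auto
    then have "Suc i mod length vs \<noteq> i" using i
      by (metis One_nat_def Suc_lessI gr_implies_not0 less_numeral_extra(3) mod_less mod_self n_not_Suc_n)
    then have sa: "s \<noteq> a" using i vs(2) unfolding s_def
      by (metis less_nat_zero_code mod_less_divisor neq0_conv nth_eq_iff_index_eq)
    have "orient a s b \<ge> 0" using vs(3)[OF i(1)] abF i(2) unfolding s_def F_def by auto
    moreover have "orient a s b = - orient a b s" by (simp add: orient_def algebra_simps)
    ultimately have "orient a b s = 0" using left[OF sH(1)] by simp
    then have "(u $ 2 * (b $ 1 - a $ 1) - u $ 1 * (b $ 2 - a $ 2)) * (u \<bullet> (s - p)) = 0"
      using key[OF abF, of s] by simp
    moreover have "perp (b - a) \<noteq> 0"
      using perp[OF abF(2) abF(1)] uu ab(1) by auto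
    then have "u $ 2 * (b $ 1 - a $ 1) - u $ 1 * (b $ 2 - a $ 2) \<noteq> 0"
      by (simp add: perp_def)
    ultimately have "s \<in> F" using sH by (simp add: F_def inner_diff_right)
    then have "s = b" using ext sH sa ab by auto
    then show ?thesis using i F pF s_def by auto
  qed
  show ?thesis
  proof (cases "e = f")
    case True
    then have "p = e" using pF ef by simp
    then obtain i where "i < length vs" "vs ! i = p"
      using ext[OF pF] vs(1) by (metis in_set_conv_nth mem_Collect_eq)
    then show ?thesis by auto
  next
    case False
    define \<kappa> where "\<kappa> = u $ 2 * (f $ 1 - e $ 1) - u $ 1 * (f $ 2 - e $ 2)"
    show ?thesis
    proof (cases "\<kappa> \<le> 0")
      case True
      have "0 \<le> orient e f x" if "x \<in> H" for x
      proof -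
        have "orient e f x * (u \<bullet> u) \<ge> 0"
          using key[OF eF, of x] True u(2)[OF that] by (simp add: \<kappa>_def inner_diff_right mult_nonpos_nonpos)
        then show ?thesis using uu by (simp add: zero_le_mult_iff)
      qed
      then show ?thesis using main[OF ef False] by blast
    next
      case k: False
      have "0 \<le> orient f e x" if "x \<in> H" for x
      proof -
        have "orient f e x * (u \<bullet> u) = (- \<kappa>) * (u \<bullet> (x - p))"
          using key[OF eF(2) eF(1), of x] by (simp add: \<kappa>_def algebra_simps)
        also have "\<dots> \<ge> 0"
          using k u(2)[OF that] by (intro mult_nonpos_nonpos) (auto simp: inner_diff_right)
        finally show ?thesis using uu by (simp add: zero_le_mult_iff)
      qed
      moreover have "F = closed_segment f e" using ef by (simp add: closed_segment_commute)
      ultimately show ?thesis using main[of f e] False by blast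
    qed
  qed
qed

lemma boundary_walk_on_edge:
  assumes "i < length vs" "p \<in> closed_segment (vs ! i) (vs ! (Suc i mod length vs))"
  shows "\<exists>\<tau>\<in>{0..<real (length vs)}. boundary_walk vs \<tau> = p"
proof -
  obtain r where r: "0 \<le> r" "r \<le> 1" "p = (1 - r) *\<^sub>R vs ! i + r *\<^sub>R vs ! (Suc i mod length vs)"
    using assms(2) by (auto simp: in_segment)
  show ?thesis
  proof (cases "r = 1")
    case True
    define j where "j = Suc i mod length vs"
    have "j < length vs" using assms(1) by (metis j_def gr_implies_not_zero mod_less_divisor neq0_conv)
    then show ?thesis using r True
      by (intro bexI[of _ "real j"]) (auto simp: boundary_walk_def j_def frac_def)
  next
    case False
    then have fl: "\<lfloor>real i + r\<rfloor> = int i" using r by linarith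
    then have fr: "frac (real i + r) = r" by (simp add: frac_def)
    have "real i + r < real (length vs)" using assms(1) r False by linarith
    moreover have "boundary_walk vs (real i + r) = p"
      unfolding boundary_walk_def fl fr Let_def by (simp add: r(3))
    ultimately show ?thesis using r by (intro bexI[of _ "real i + r"]) auto
  qed
qed

theorem ccw_source_order_exists:
  assumes "flamecast I" "convex_instance I"
  shows "\<exists>xs. ccw_source_order I xs"
proof -
  have fin: "finite (source_pos I ` sources I \<union> sink_pos I ` sinks I)" "finite (sources I)"
    using assms(1) by (auto simp: flamecast_def)
  then obtain vs where vs: "ccw_corners (instance_hull I) vs"
    using ccw_corners_exists unfolding instance_hull_def by blast
  have "compact (instance_hull I)" "convex (instance_hull I)"
    using fin by (auto simp: instance_hull_def finite_imp_compact_convex_hull)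
  then have "\<exists>\<tau>. \<tau> \<in> {0..<real (length vs)} \<and> boundary_walk vs \<tau> = source_pos I s"
    if "s \<in> sources I" for s
    using frontier_on_edge[OF vs] boundary_walk_on_edge assms(2) that
    unfolding convex_instance_def by blast
  then obtain \<tau> where \<tau>: "\<forall>s\<in>sources I. \<tau> s \<in> {0..<real (length vs)} \<and> boundary_walk vs (\<tau> s) = source_pos I s"
    by metis
  obtain l where l: "set l = sources I" "distinct l"
    using finite_distinct_list fin(2) by blast
  have "ccw_source_order I (sort_key \<tau> l)"
    unfolding ccw_source_order_def using l vs \<tau>
    by (intro conjI exI[of _ vs] exI[of _ \<tau>]) auto
  then show ?thesis by blast
qed

end

theory Submission
  imports Defs
begin

text \<open>
  Call the Steiner points and the sink sites. For \<open>\<alpha> = 0\<close> every source may be attached to a closest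
  site, so an optimal layout amounts to an optimal finite set of Steiner points; take one of least
  cardinality. Then each Steiner point \<open>z\<close> has a source \<open>a\<^sub>1\<close> strictly closer to \<open>z\<close> than to any other
  site, since otherwise \<open>z\<close> could be dropped.

  Suppose the sources of \<open>z\<close> form at least four cyclic runs: there are sources
  \<open>a\<^sub>1, b\<^sub>1, \<dots>, a\<^sub>4, b\<^sub>4\<close> in cyclic order, the \<open>a\<^sub>i\<close> attached to \<open>z\<close> and each \<open>b\<^sub>i\<close> to some site
  \<open>w\<^sub>i \<noteq> z\<close>. If \<open>a, a'\<close> separate \<open>b\<^sub>i\<close> from \<open>b\<^sub>j\<close> on the boundary, the path \<open>b\<^sub>i w\<^sub>i w\<^sub>j b\<^sub>j\<close> meets the path
  \<open>a z a'\<close>; as segments from sources to closest sites do not cross, it is \<open>w\<^sub>i w\<^sub>j\<close> that meets \<open>z a\<close> or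
  \<open>z a'\<close>, and this forces the angle \<open>w\<^sub>i z w\<^sub>j\<close> to be at least a right angle. Four vectors in the plane
  with this property consist of two orthogonal pairs of opposite vectors. In the orthogonal case the
  source on the spoke that is met is the midpoint of \<open>w\<^sub>i w\<^sub>j\<close>; it cannot be \<open>a\<^sub>1\<close>, so \<open>a\<^sub>2\<close> is the
  midpoint of \<open>w\<^sub>1 w\<^sub>j\<close> for two different \<open>j\<close>, which is absurd.

  Hence every group has at most three cyclic runs, and cutting the cyclic order between two sources
  of different groups does not split any run.
\<close>

section \<open>Separation by two radial segments of a convex set\<close>

text \<open>For \<open>r > 1\<close> the point \<open>y\<close> would lie strictly between the
  interior point \<open>v\<close> and the point \<open>x\<close> of the closure, hence in the
  interior.\<close>

lemma frontier_ray_scale_le_1: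
  fixes H :: "'a::euclidean_space set"
  assumes "convex H" "v \<in> interior H" "y \<in> frontier H" "x \<in> closure H" "x - v = r *\<^sub>R (y - v)"
  shows "r \<le> 1"
proof (rule ccontr)
  assume r: "\<not> r \<le> 1"
  have "y \<noteq> v" using assms(2,3) by (auto simp: frontier_def)
  have y: "y = (1 - 1 / r) *\<^sub>R v + (1 / r) *\<^sub>R x"
  proof -
    have "x = v + r *\<^sub>R (y - v)" using assms(5) by (simp add: algebra_simps)
    then show ?thesis using r by (simp add: scaleR_right_distrib scaleR_left_diff_distrib)
  qed
  have "v \<noteq> x" using assms(5) \<open>y \<noteq> v\<close> r by auto
  then have "y \<in> open_segment v x"
    unfolding in_segment using y r by (intro conjI exI[of _ "1 / r"]) auto
  then have "y \<in> interior H"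
    using in_interior_closure_convex_segment[OF assms(1,2,4)] by blast
  then show False using assms(3) by (simp add: frontier_def)
qed

text \<open>The scale bound applies in both directions, to \<open>r\<close> and to
  \<open>1 / r\<close>.\<close>

lemma frontier_ray_unique:
  fixes H :: "'a::euclidean_space set"
  assumes "convex H" "v \<in> interior H" "y \<in> frontier H" "x \<in> frontier H"
    and "x - v = r *\<^sub>R (y - v)" "0 \<le> r"
  shows "x = y"
proof -
  have "x \<noteq> v" using assms(2,4) by (auto simp: frontier_def)
  then have "r \<noteq> 0" using assms(5) by auto
  moreover have "r \<le> 1"
    using frontier_ray_scale_le_1[OF assms(1-3) _ assms(5)] assms(4) by (simp add: frontier_def)
  moreover have "1 / r \<le> 1"
    using \<open>r \<noteq> 0\<close> assms(3,5)
    by (intro frontier_ray_scale_le_1[OF assms(1,2,4), of y]) (auto simp: frontier_def)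
  ultimately have "r = 1" using assms(6) by (simp add: divide_le_eq)
  then show ?thesis using assms(5) by simp
qed

text \<open>\<open>Arg2pi\<close> jumps only along the nonnegative reals; dividing by
  \<open>d\<close> turns this cut into the ray spanned by \<open>d\<close>.\<close>

lemma continuous_on_Arg2pi_ratio:
  fixes d :: complex
  assumes "continuous_on S h" "\<And>x. x \<in> S \<Longrightarrow> h x / d \<notin> \<real>\<^sub>\<ge>\<^sub>0"
  shows "continuous_on S (\<lambda>x. Arg2pi (h x / d))"
proof -
  have "continuous_on (- \<real>\<^sub>\<ge>\<^sub>0) Arg2pi"
    by (intro continuous_at_imp_continuous_on) (auto intro: continuous_at_Arg2pi)
  moreover have "continuous_on S (\<lambda>x. h x / d)"
    using assms(1) unfolding divide_inverse by (intro continuous_intros)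
  ultimately show ?thesis
    by (rule continuous_on_compose2) (use assms(2) in blast)
qed

text \<open>
  Seen from an interior point, the polar angle is injective, hence monotone, along an arc of the
  frontier. This is the only topology needed: no orientation enters.
\<close>

lemma connected_meets_radial_segment:
  fixes H :: "(real^2) set" and g :: "real \<Rightarrow> real^2"
  assumes H: "convex H" "v \<in> interior H"
    and g: "continuous_on {p..q} g" "inj_on g (insert r {p..q})" "g ` insert r {p..q} \<subseteq> frontier H"
    and pq: "r \<notin> {p..q}" "p < m" "m < q"
    and \<Gamma>: "connected \<Gamma>" "\<Gamma> \<subseteq> H" "g p \<in> \<Gamma>" "g q \<in> \<Gamma>"
  shows "\<Gamma> \<inter> (closed_segment v (g r) \<union> closed_segment v (g m)) \<noteq> {}"
proof (rule ccontr)
  assume "\<not> ?thesis"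
  then have avoid: "x \<notin> closed_segment v (g r)" "x \<notin> closed_segment v (g m)" if "x \<in> \<Gamma>" for x
    using that by auto
  define c :: "real^2 \<Rightarrow> complex" where "c x = Complex ((x - v) $ 1) ((x - v) $ 2)" for x
  have c_eq: "x - v = k *\<^sub>R (y - v)" if "c x = of_real k * c y" for x y k
    using that by (simp add: c_def vec_eq_iff forall_2 complex_eq_iff)
  have c_0: "c x = 0 \<longleftrightarrow> x = v" for x
    by (simp add: c_def vec_eq_iff forall_2 complex_eq_iff)
  have cont_c: "continuous_on S c" for S
    unfolding c_def Complex_eq by (intro continuous_intros)
  \<comment> \<open>The cut is put on the ray through \<open>g r\<close>: the arc avoids that ray
    because \<open>g r\<close> is the only frontier point on it, and \<Gamma> avoids it because,
    inside \<open>H\<close>, the ray is covered by the spoke to \<open>g r\<close>.\<close>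
  define d where "d = c (g r)"
  have fr: "g \<sigma> \<in> frontier H" if "\<sigma> \<in> insert r {p..q}" for \<sigma>
    using g(3) that by blast
  have nv: "g \<sigma> \<noteq> v" if "\<sigma> \<in> insert r {p..q}" for \<sigma>
    using fr[OF that] H(2) by (auto simp: frontier_def)
  have d: "d \<noteq> 0" using nv[of r] by (simp add: d_def c_0)
  have nonneg: "\<exists>k\<ge>0. x - v = k *\<^sub>R (g r - v)" if nn: "c x / d \<in> \<real>\<^sub>\<ge>\<^sub>0" for x
  proof -
    obtain k where k: "c x / d = of_real k" "0 \<le> k" using nn by (rule nonneg_Reals_cases)
    then have "c x = of_real k * c (g r)" using d by (simp add: d_def field_simps)
    then show ?thesis using c_eq k(2) by blast
  qed
  have same_angle: "\<exists>k>0. x - v = k *\<^sub>R (y - v)"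
    if eq: "Arg2pi (c x / d) = Arg2pi (c y / d)" and "x \<noteq> v" "y \<noteq> v" for x y
  proof -
    have "c x / d \<noteq> 0" "c y / d \<noteq> 0" using that(2,3) d c_0 by auto
    then obtain k where "k > 0" "c x / d = of_real k * (c y / d)"
      using eq Arg2pi_eq_iff[of "c x / d" "c y / d"] by auto
    moreover from this(2) have "c x = of_real k * c y" using d by (simp add: field_simps)
    ultimately show ?thesis using c_eq by blast
  qed
  define f where "f = (\<lambda>\<sigma>. Arg2pi (c (g \<sigma>) / d))"
  have "continuous_on {p..q} f"
    unfolding f_def
  proof (rule continuous_on_Arg2pi_ratio)
    show "continuous_on {p..q} (\<lambda>\<sigma>. c (g \<sigma>))"
      by (rule continuous_on_compose2[OF cont_c g(1)]) auto
    fix \<sigma> assume \<sigma>: "\<sigma> \<in> {p..q}"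
    show "c (g \<sigma>) / d \<notin> \<real>\<^sub>\<ge>\<^sub>0"
    proof
      assume "c (g \<sigma>) / d \<in> \<real>\<^sub>\<ge>\<^sub>0"
      then have "g \<sigma> = g r"
        using nonneg frontier_ray_unique[OF H fr[of r] fr[of \<sigma>]] \<sigma> by blast
      then have "\<sigma> = r" using g(2) \<sigma> by (auto simp: inj_on_def)
      then show False using pq(1) \<sigma> by blast
    qed
  qed
  moreover have "inj_on f {p..q}"
  proof (rule inj_onI)
    fix x y assume xy: "x \<in> {p..q}" "y \<in> {p..q}" "f x = f y"
    then obtain k where "k > 0" "g x - v = k *\<^sub>R (g y - v)"
      using same_angle[of "g x" "g y"] nv unfolding f_def by blast
    then have "g x = g y"
      using frontier_ray_unique[OF H fr[of y] fr[of x], of k] xy by auto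
    then show "x = y" using g(2) xy by (auto simp: inj_on_def)
  qed
  ultimately have between: "(f p < f m \<and> f m < f q) \<or> (f q < f m \<and> f m < f p)"
    using continuous_inj_imp_mono[of p m q f] pq by blast
  define F where "F = (\<lambda>x. Arg2pi (c x / d))"
  have "continuous_on \<Gamma> F"
    unfolding F_def
  proof (rule continuous_on_Arg2pi_ratio[OF cont_c])
    fix x assume x: "x \<in> \<Gamma>"
    show "c x / d \<notin> \<real>\<^sub>\<ge>\<^sub>0"
    proof
      assume "c x / d \<in> \<real>\<^sub>\<ge>\<^sub>0"
      then obtain k where k: "k \<ge> 0" "x - v = k *\<^sub>R (g r - v)" using nonneg by blast
      moreover have "k \<le> 1"
        using frontier_ray_scale_le_1[OF H fr[of r] _ k(2)] x \<Gamma>(2) closure_subset by blast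
      ultimately have "x \<in> closed_segment v (g r)"
        unfolding in_segment by (intro exI[of _ k]) (simp add: algebra_simps)
      then show False using avoid(1)[OF x] by blast
    qed
  qed
  then have conn: "connected (F ` \<Gamma>)" using \<Gamma>(1) by (simp add: connected_continuous_image)
  \<comment> \<open>Intermediate value: some point \<open>x\<close> of \<Gamma> is seen at the angle
    of \<open>g m\<close>; being in \<open>H\<close> it is not beyond \<open>g m\<close>, so it lies
    on the spoke.\<close>
  have "f p \<in> F ` \<Gamma>" "f q \<in> F ` \<Gamma>" using \<Gamma>(3,4) by (auto simp: f_def F_def)
  then have "f m \<in> F ` \<Gamma>" using connectedD_interval[OF conn] between by (meson less_imp_le)
  then obtain x where x: "x \<in> \<Gamma>" "Arg2pi (c (g m) / d) = Arg2pi (c x / d)"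
    by (auto simp: f_def F_def)
  have "x \<noteq> v" using avoid[OF x(1)] by auto
  then obtain k where k: "k > 0" "x - v = k *\<^sub>R (g m - v)"
    using same_angle[of x "g m"] nv[of m] x(2) pq by auto
  moreover have "k \<le> 1"
    using frontier_ray_scale_le_1[OF H fr[of m] _ k(2)] x(1) \<Gamma>(2) closure_subset pq by auto
  ultimately have "x \<in> closed_segment v (g m)"
    unfolding in_segment by (intro exI[of _ k]) (simp add: algebra_simps)
  then show False using avoid(2)[OF x(1)] by blast
qed

text \<open>The apex \<open>v\<close> may now be on the frontier. A compact \<Gamma> missing both
  spokes keeps a distance \<delta> from them; an interior apex \<open>u\<close> closer than \<delta>
  to \<open>v\<close> displaces every point of the spokes by less than \<delta>, which contradicts
  the interior case.\<close>

lemma connected_meets_radial_segment_closed: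
  fixes H :: "(real^2) set" and g :: "real \<Rightarrow> real^2"
  assumes H: "convex H" "interior H \<noteq> {}" "v \<in> H"
    and g: "continuous_on {p..q} g" "inj_on g (insert r {p..q})" "g ` insert r {p..q} \<subseteq> frontier H"
    and pq: "r \<notin> {p..q}" "p < m" "m < q"
    and \<Gamma>: "connected \<Gamma>" "compact \<Gamma>" "\<Gamma> \<subseteq> H" "g p \<in> \<Gamma>" "g q \<in> \<Gamma>"
  shows "\<Gamma> \<inter> (closed_segment v (g r) \<union> closed_segment v (g m)) \<noteq> {}"
proof
  define K where "K = (\<lambda>u. closed_segment u (g r) \<union> closed_segment u (g m))"
  assume "\<Gamma> \<inter> (closed_segment v (g r) \<union> closed_segment v (g m)) = {}"
  then have "\<Gamma> \<inter> K v = {}" "closed (K v)" by (auto simp: K_def closed_Un)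
  then obtain \<delta> where \<delta>: "\<delta> > 0" "\<And>x y. x \<in> \<Gamma> \<Longrightarrow> y \<in> K v \<Longrightarrow> \<delta> \<le> dist x y"
    using separate_compact_closed[OF \<Gamma>(2)] by metis
  have "v \<in> closure (interior H)"
    using H convex_closure_interior closure_subset by blast
  then obtain u where u: "u \<in> interior H" "dist u v < \<delta>"
    using \<delta>(1) closure_approachable by blast
  obtain x where x: "x \<in> \<Gamma>" "x \<in> K u"
    using connected_meets_radial_segment[OF H(1) u(1) g pq \<Gamma>(1,3-5)] by (auto simp: K_def)
  obtain e where e: "e \<in> {g r, g m}" "x \<in> closed_segment u e" using x(2) by (auto simp: K_def)
  obtain s where s: "0 \<le> s" "s \<le> 1" "x = (1 - s) *\<^sub>R u + s *\<^sub>R e" using e(2) by (auto simp: in_segment)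
  define y where "y = (1 - s) *\<^sub>R v + s *\<^sub>R e"
  have "y \<in> K v" using e(1) s by (auto simp: K_def in_segment y_def)
  moreover have "dist x y \<le> dist u v"
  proof -
    have "x - y = (1 - s) *\<^sub>R (u - v)" by (simp add: s(3) y_def algebra_simps)
    then have "dist x y = (1 - s) * dist u v" using s by (simp add: dist_norm)
    also have "\<dots> \<le> 1 * dist u v" using s by (intro mult_right_mono) auto
    finally show ?thesis by simp
  qed
  ultimately show False using \<delta>(2)[OF x(1)] u(2) by fastforce
qed

section \<open>The boundary walk\<close>

lemma orient_affine:
  "orient a b ((1 - u) *\<^sub>R x + u *\<^sub>R y) = (1 - u) * orient a b x + u * orient a b y"
  by (simp add: orient_def algebra_simps)

lemma orient_swap: "orient b a x = - orient a b x"
  by (simp add: orient_def algebra_simps)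

lemma orient_zero_not_interior:
  assumes "\<forall>x\<in>H. 0 \<le> orient a b x" "a \<noteq> b" "orient a b p = 0"
  shows "p \<notin> interior H"
proof
  assume "p \<in> interior H"
  then obtain e where e: "e > 0" "ball p e \<subseteq> H" by (meson mem_interior)
  \<comment> \<open>A normal pointing to the right of the edge: \<open>orient a b\<close> decreases
    along it, and a step of length \<open>e / 2\<close> stays in the ball.\<close>
  define w :: "real^2" where "w = vector [b $ 2 - a $ 2, - (b $ 1 - a $ 1)]"
  have w: "w \<noteq> 0" using assms(2) by (auto simp: w_def vec_eq_iff forall_2)
  define k where "k = e / (2 * norm w)"
  have k: "k > 0" using e(1) w by (simp add: k_def)
  have "p + k *\<^sub>R w \<in> ball p e"
    using e(1) w by (simp add: dist_norm k_def)
  then have "0 \<le> orient a b (p + k *\<^sub>R w)" using e(2) assms(1) by blast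
  also have "orient a b (p + k *\<^sub>R w) = orient a b p - k * (w \<bullet> w)"
    by (simp add: orient_def w_def inner_vec_def sum_2 algebra_simps)
  finally have "k * (w \<bullet> w) \<le> 0" using assms(3) by simp
  then show False using k w by (simp add: mult_le_0_iff inner_gt_zero_iff flip: not_less)
qed

lemma orient_zero_imp_on_line:
  assumes "a \<noteq> b" "orient a b c = 0"
  obtains s where "c = (1 - s) *\<^sub>R a + s *\<^sub>R b"
proof -
  define N where "N = (b $ 1 - a $ 1)\<^sup>2 + (b $ 2 - a $ 2)\<^sup>2"
  \<comment> \<open>The parameter of the orthogonal projection of \<open>c\<close> to the line
    through \<open>a\<close> and \<open>b\<close>.\<close>
  define s where "s = ((c $ 1 - a $ 1) * (b $ 1 - a $ 1) + (c $ 2 - a $ 2) * (b $ 2 - a $ 2)) / N"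
  have N: "N \<noteq> 0"
    using assms(1) by (auto simp: N_def vec_eq_iff forall_2 sum_power2_eq_zero_iff)
  have "N * (c $ 1) = N * ((1 - s) * a $ 1 + s * b $ 1)" "N * (c $ 2) = N * ((1 - s) * a $ 2 + s * b $ 2)"
  proof -
    have sN: "s * N = (c $ 1 - a $ 1) * (b $ 1 - a $ 1) + (c $ 2 - a $ 2) * (b $ 2 - a $ 2)"
      using N by (simp add: s_def)
    show "N * (c $ 1) = N * ((1 - s) * a $ 1 + s * b $ 1)" "N * (c $ 2) = N * ((1 - s) * a $ 2 + s * b $ 2)"
      using sN assms(2) unfolding N_def orient_def by algebra+
  qed
  then have "c = (1 - s) *\<^sub>R a + s *\<^sub>R b"
    using N by (simp add: vec_eq_iff forall_2)
  then show ?thesis using that by blast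
qed

text \<open>Of three distinct collinear points one lies strictly between the other two and is not
  extreme. The position of \<open>s\<close> relative to 0 and 1 decides which one; in the two outer
  cases \<open>k\<close> is its parameter between the others.\<close>

lemma extreme_points_collinear:
  assumes "a extreme_point_of H" "b extreme_point_of H" "c extreme_point_of H"
    and "a \<noteq> b" "orient a b c = 0"
  shows "c = a \<or> c = b"
proof (rule ccontr)
  assume neq: "\<not> (c = a \<or> c = b)"
  obtain s where s: "c = (1 - s) *\<^sub>R a + s *\<^sub>R b"
    using orient_zero_imp_on_line[OF assms(4,5)] by blast
  have ext: "x \<notin> open_segment y z" if "x extreme_point_of H" "y extreme_point_of H" "z extreme_point_of H" for x y z
    using that unfolding extreme_point_of_def by blast
  have "s \<noteq> 0" "s \<noteq> 1" using s neq by auto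
  then consider "0 < s" "s < 1" | "s < 0" | "s > 1" by linarith
  then show False
  proof cases
    case 1
    then have "c \<in> open_segment a b" using s assms(4) by (auto simp: in_segment)
    then show False using ext assms by blast
  next
    case 2
    define k where "k = 1 / (1 - s)"
    have "(1 - s) *\<^sub>R a = c - s *\<^sub>R b" using s by simp
    then have "k *\<^sub>R ((1 - s) *\<^sub>R a) = k *\<^sub>R (c - s *\<^sub>R b)" by simp
    then have "a = k *\<^sub>R c - (k * s) *\<^sub>R b" using 2 by (simp add: k_def scaleR_right_diff_distrib)
    moreover have "k * s = k - 1" using 2 by (simp add: k_def field_simps)
    ultimately have "a = (1 - k) *\<^sub>R b + k *\<^sub>R c" by (simp add: algebra_simps)
    moreover have "0 < k" "k < 1" using 2 by (auto simp: k_def)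
    ultimately have "a \<in> open_segment b c" using neq unfolding in_segment by blast
    then show False using ext assms by blast
  next
    case 3
    define k where "k = 1 / s"
    have "s *\<^sub>R b = c - (1 - s) *\<^sub>R a" using s by simp
    then have "k *\<^sub>R (s *\<^sub>R b) = k *\<^sub>R (c - (1 - s) *\<^sub>R a)" by simp
    then have "b = k *\<^sub>R c - (k * (1 - s)) *\<^sub>R a" using 3 by (simp add: k_def scaleR_right_diff_distrib)
    moreover have "k * (1 - s) = k - 1" using 3 by (simp add: k_def field_simps)
    ultimately have "b = (1 - k) *\<^sub>R a + k *\<^sub>R c" by (simp add: algebra_simps)
    moreover have "0 < k" "k < 1" using 3 by (auto simp: k_def)
    ultimately have "b \<in> open_segment a c" using neq unfolding in_segment by blast
    then show False using ext assms by blast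
  qed
qed

section \<open>Continuity and injectivity of the walk\<close>

lemma boundary_walk_segment:
  assumes "\<tau> \<in> {0..<real (length vs)}"
  obtains i f where "i < length vs" "0 \<le> f" "f < 1" "\<tau> = real i + f" "Suc i mod length vs < length vs"
    "boundary_walk vs \<tau> = (1 - f) *\<^sub>R vs ! i + f *\<^sub>R vs ! (Suc i mod length vs)"
proof -
  define i where "i = nat \<lfloor>\<tau>\<rfloor>"
  have "\<tau> = real i + frac \<tau>" using assms by (simp add: i_def frac_def)
  moreover have "i < length vs" using assms by (simp add: i_def) linarith
  moreover have "Suc i mod length vs < length vs" using calculation(2) by (intro mod_less_divisor) auto
  ultimately show ?thesis
    using that[of i "frac \<tau>"] by (simp add: boundary_walk_def Let_def frac_lt_1 flip: i_def)
qed

text \<open>On each edge the walk is affine in the parameter; finitely many closed pieces are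
  glued.\<close>

lemma continuous_on_boundary_walk:
  assumes "0 \<le> p" "q < real (length vs)"
  shows "continuous_on {p..q} (boundary_walk vs)"
proof -
  define n where "n = length vs"
  define U where "U i = {real i..real (Suc i)} \<inter> {p..q}" for i
  have "continuous_on (U i) (boundary_walk vs)" if "i < n" for i
  proof -
    have "boundary_walk vs \<tau> = (1 - (\<tau> - real i)) *\<^sub>R vs ! i + (\<tau> - real i) *\<^sub>R vs ! (Suc i mod n)"
      if \<tau>: "\<tau> \<in> U i" for \<tau>
    proof (cases "\<tau> = real (Suc i)")
      \<comment> \<open>At the right end of the piece the floor has already moved on to
        \<open>Suc i\<close>; by \<open>q < length vs\<close> this is still the index of a
        corner.\<close>
      case True
      then have "Suc i < n" using \<tau> assms(2) by (auto simp: U_def n_def)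
      then show ?thesis using True by (simp add: boundary_walk_def n_def nat_add_distrib frac_def)
    next
      case False
      then have "\<lfloor>\<tau>\<rfloor> = int i" using \<tau> unfolding U_def by (simp add: floor_eq_iff)
      then show ?thesis by (simp add: boundary_walk_def frac_def n_def)
    qed
    moreover have "continuous_on (U i)
        (\<lambda>\<tau>. (1 - (\<tau> - real i)) *\<^sub>R vs ! i + (\<tau> - real i) *\<^sub>R vs ! (Suc i mod n))"
      by (intro continuous_intros)
    ultimately show ?thesis by (simp cong: continuous_on_cong)
  qed
  then have "continuous_on (\<Union>i<n. U i) (boundary_walk vs)"
    by (intro continuous_on_closed_Union) (auto simp: U_def)
  moreover have "{p..q} \<subseteq> (\<Union>i<n. U i)"
  proof
    fix \<tau> assume \<tau>: "\<tau> \<in> {p..q}"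
    define i where "i = nat \<lfloor>\<tau>\<rfloor>"
    have "real i \<le> \<tau>" "\<tau> \<le> real (Suc i)" "i < n"
      using \<tau> assms by (auto simp: i_def n_def) linarith+
    then show "\<tau> \<in> (\<Union>i<n. U i)" using \<tau> by (auto simp: U_def)
  qed
  ultimately show ?thesis using continuous_on_subset by blast
qed

text \<open>A corner equal to its successor is the only corner, and then \<open>H\<close>, as the
  hull of its extreme points, is a single point.\<close>

lemma ccw_corners_neq_next:
  assumes "ccw_corners H vs" "compact H" "convex H" "interior H \<noteq> {}" "i < length vs"
  shows "vs ! i \<noteq> vs ! (Suc i mod length vs)"
proof
  assume eq: "vs ! i = vs ! (Suc i mod length vs)"
  have "distinct vs" using assms(1) by (simp add: ccw_corners_def)
  moreover have "Suc i mod length vs < length vs" using assms(5) by (intro mod_less_divisor) auto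
  ultimately have "Suc i mod length vs = i" using eq assms(5) by (simp add: nth_eq_iff_index_eq)
  then have "length vs = 1"
    using assms(5) by (cases "Suc i = length vs") auto
  then obtain a where "vs = [a]" by (auto simp: length_Suc_conv)
  then have "{x. x extreme_point_of H} = {a}" using assms(1) by (simp add: ccw_corners_def)
  then have "H = {a}" using Krein_Milman_Minkowski[OF assms(2,3)] by simp
  then show False using assms(4) by simp
qed

text \<open>The walk stays on the edges, where \<open>orient\<close> vanishes, while
  \<open>H\<close> lies on one side of each edge line.\<close>

lemma boundary_walk_frontier:
  assumes "ccw_corners H vs" "compact H" "convex H" "interior H \<noteq> {}" "\<tau> \<in> {0..<real (length vs)}"
  shows "boundary_walk vs \<tau> \<in> frontier H"
proof -
  obtain i f where i: "i < length vs" "0 \<le> f" "f < 1" "Suc i mod length vs < length vs"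
    and w: "boundary_walk vs \<tau> = (1 - f) *\<^sub>R vs ! i + f *\<^sub>R vs ! (Suc i mod length vs)"
    using boundary_walk_segment[OF assms(5)] by metis
  have "vs ! i \<in> H" "vs ! (Suc i mod length vs) \<in> H"
    using i nth_mem assms(1) unfolding ccw_corners_def extreme_point_of_def by blast+
  then have "boundary_walk vs \<tau> \<in> H"
    unfolding w using i \<open>convex H\<close> by (intro convexD) auto
  moreover have "orient (vs ! i) (vs ! (Suc i mod length vs)) (boundary_walk vs \<tau>) = 0"
    unfolding w orient_affine by (simp add: orient_def)
  then have "boundary_walk vs \<tau> \<notin> interior H"
    using ccw_corners_neq_next[OF assms(1-4) i(1)] assms(1) i(1)
    by (intro orient_zero_not_interior) (auto simp: ccw_corners_def)
  ultimately show ?thesis using closure_subset by (auto simp: frontier_def)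
qed

text \<open>A corner is listed only once. If edges \<open>i\<close> and \<open>j\<close> share a
  point that is not a corner, both ends of edge \<open>j\<close> lie on the line of edge
  \<open>i\<close>, since neither can be to its right; being extreme, they are the ends of edge
  \<open>i\<close>. So the edges agree up to direction, and opposite directions would flatten
  \<open>H\<close>.\<close>

lemma inj_on_boundary_walk:
  assumes ccw: "ccw_corners H vs" and H: "compact H" "convex H" "interior H \<noteq> {}"
  shows "inj_on (boundary_walk vs) {0..<real (length vs)}"
proof (rule inj_onI)
  define nxt where "nxt i = Suc i mod length vs" for i
  have vs: "distinct vs" "set vs = {x. x extreme_point_of H}"
    and left: "\<And>i x. i < length vs \<Longrightarrow> x \<in> H \<Longrightarrow> 0 \<le> orient (vs ! i) (vs ! nxt i) x"
    using ccw by (auto simp: ccw_corners_def nxt_def)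
  have ext: "vs ! i extreme_point_of H" if "i < length vs" for i
    using vs(2) nth_mem[OF that] by blast
  have neq: "vs ! i \<noteq> vs ! nxt i" if "i < length vs" for i
    using ccw_corners_neq_next[OF assms that] by (simp add: nxt_def)
  have corner: "f = 0" "p = vs ! i"
    if "i < length vs" "nxt i < length vs" "0 \<le> f" "f < 1" "p = (1 - f) *\<^sub>R vs ! i + f *\<^sub>R vs ! nxt i"
       "p extreme_point_of H" for i f p
  proof -
    show "f = 0"
    proof (rule ccontr)
      assume "f \<noteq> 0"
      then have "p \<in> open_segment (vs ! i) (vs ! nxt i)"
        using that neq[OF that(1)] unfolding in_segment by (intro conjI exI[of _ f]) auto
      then show False using that(6) ext[OF that(1)] ext[OF that(2)] unfolding extreme_point_of_def by blast
    qed
    then show "p = vs ! i" using that by simp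
  qed
  fix \<tau> \<sigma> assume dom: "\<tau> \<in> {0..<real (length vs)}" "\<sigma> \<in> {0..<real (length vs)}"
    and eq: "boundary_walk vs \<tau> = boundary_walk vs \<sigma>"
  define p where "p = boundary_walk vs \<tau>"
  obtain i f where i: "i < length vs" "0 \<le> f" "f < 1" "\<tau> = real i + f" "nxt i < length vs"
    and pi: "p = (1 - f) *\<^sub>R vs ! i + f *\<^sub>R vs ! nxt i"
    using boundary_walk_segment[OF dom(1)] unfolding nxt_def p_def by metis
  obtain j g where j: "j < length vs" "0 \<le> g" "g < 1" "\<sigma> = real j + g" "nxt j < length vs"
    and pj: "p = (1 - g) *\<^sub>R vs ! j + g *\<^sub>R vs ! nxt j"
    using boundary_walk_segment[OF dom(2)] eq unfolding nxt_def p_def by metis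
  show "\<tau> = \<sigma>"
  proof (cases "p extreme_point_of H")
    case True
    then have "f = 0" "p = vs ! i" "g = 0" "p = vs ! j"
      using corner[OF i(1,5,2,3) pi] corner[OF j(1,5,2,3) pj] by auto
    then have "i = j" using vs(1) i(1) j(1) by (metis nth_eq_iff_index_eq)
    then show ?thesis using i j \<open>f = 0\<close> \<open>g = 0\<close> by simp
  next
    case False
    have g0: "g > 0" using False ext[OF j(1)] pj j(2) by (cases "g = 0") auto
    have "orient (vs ! i) (vs ! nxt i) p = 0"
      unfolding pi orient_affine by (simp add: orient_def)
    then have sum0: "(1 - g) * orient (vs ! i) (vs ! nxt i) (vs ! j)
        + g * orient (vs ! i) (vs ! nxt i) (vs ! nxt j) = 0"
      unfolding pj orient_affine .
    have inH: "vs ! j \<in> H" "vs ! nxt j \<in> H"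
      using ext[OF j(1)] ext[OF j(5)] by (auto simp: extreme_point_of_def)
    have "orient (vs ! i) (vs ! nxt i) (vs ! j) \<ge> 0" "orient (vs ! i) (vs ! nxt i) (vs ! nxt j) \<ge> 0"
      using left[OF i(1)] inH by auto
    then have "(1 - g) * orient (vs ! i) (vs ! nxt i) (vs ! j) \<ge> 0"
        "g * orient (vs ! i) (vs ! nxt i) (vs ! nxt j) \<ge> 0"
      using j g0 by auto
    then have "orient (vs ! i) (vs ! nxt i) (vs ! j) = 0" "orient (vs ! i) (vs ! nxt i) (vs ! nxt j) = 0"
      using sum0 g0 j(3) by (auto simp: add_nonneg_eq_0_iff)
    then have on: "vs ! j = vs ! i \<or> vs ! j = vs ! nxt i" "vs ! nxt j = vs ! i \<or> vs ! nxt j = vs ! nxt i"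
      using extreme_points_collinear[OF ext[OF i(1)] ext[OF i(5)] _ neq[OF i(1)]] ext[OF j(1)] ext[OF j(5)]
      by auto
    have "vs ! j = vs ! i"
    proof (rule ccontr)
      assume "vs ! j \<noteq> vs ! i"
      then have sw: "vs ! j = vs ! nxt i" "vs ! nxt j = vs ! i" using on neq[OF j(1)] by auto
      obtain x where x: "x \<in> interior H" using H(3) by blast
      have "orient (vs ! i) (vs ! nxt i) y = 0" if "y \<in> H" for y
        using left[OF i(1) that] left[OF j(1) that] orient_swap[of "vs ! nxt i" "vs ! i" y] unfolding sw by simp
      then have "orient (vs ! i) (vs ! nxt i) x = 0" using x interior_subset by blast
      then have "x \<notin> interior H"
        using left[OF i(1)] neq[OF i(1)] by (intro orient_zero_not_interior) auto
      then show False using x by blast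
    qed
    then have ij: "i = j" using vs(1) i(1) j(1) by (metis nth_eq_iff_index_eq)
    have "(f - g) *\<^sub>R (vs ! nxt i - vs ! i) = 0"
      using pi pj unfolding ij by (simp add: algebra_simps)
    then have "f = g" using neq[OF i(1)] by simp
    then show ?thesis using i j ij by simp
  qed
qed

text \<open>An empty interior bounds the affine dimension by one, so \<open>H\<close> is empty or a
  segment, whose only extreme points are its ends.\<close>

lemma flat_hull_few_corners:
  fixes H :: "(real^2) set"
  assumes "compact H" "convex H" "interior H = {}" "ccw_corners H vs"
  shows "collinear H" "length vs \<le> 2"
proof -
  show col: "collinear H"
  proof (cases "H = {}")
    case False
    then have "aff_dim H \<noteq> 2"
      using assms interior_rel_interior_gen[of H] rel_interior_eq_empty[OF assms(2)] by auto
    moreover have "aff_dim H \<le> 2" using aff_dim_le_DIM[of H] by simp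
    ultimately show ?thesis by (simp add: collinear_aff_dim)
  qed simp
  show "length vs \<le> 2"
  proof (cases "H = {}")
    case True
    then have "set vs = {}" using assms(4) by (auto simp: ccw_corners_def extreme_point_of_def)
    then show ?thesis by simp
  next
    case False
    then obtain e f where "H = closed_segment e f"
      using compact_convex_collinear_segment assms(1,2) col by metis
    then have "set vs \<subseteq> {e, f}" "distinct vs"
      using assms(4) by (auto simp: ccw_corners_def extreme_point_of_segment)
    then have "length vs \<le> card {e, f}" by (metis card_mono distinct_card finite.emptyI finite.insertI)
    also have "\<dots> \<le> 2" by (simp add: card_insert_if)
    finally show ?thesis .
  qed
qed

section \<open>Closest sites\<close>

text \<open>It suffices that at most one of the other vectors has a negative inner product with
  \<open>u1\<close>. Two such vectors lie on opposite sides of the line of \<open>u1\<close>, as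
  their mutual inner product is not positive; the third must then lie on that line, opposite to
  \<open>u1\<close>, and so has a positive inner product with both.\<close>

lemma four_vectors_nonpos_inner:
  fixes u1 u2 u3 u4 :: "real^2"
  assumes "u1 \<noteq> 0" "u2 \<noteq> 0" "u3 \<noteq> 0" "u4 \<noteq> 0"
    and "u1 \<bullet> u2 \<le> 0" "u1 \<bullet> u3 \<le> 0" "u1 \<bullet> u4 \<le> 0"
    and "u2 \<bullet> u3 \<le> 0" "u2 \<bullet> u4 \<le> 0" "u3 \<bullet> u4 \<le> 0"
  shows "(u1 \<bullet> u2 = 0 \<and> u1 \<bullet> u3 = 0) \<or> (u1 \<bullet> u2 = 0 \<and> u1 \<bullet> u4 = 0) \<or> (u1 \<bullet> u3 = 0 \<and> u1 \<bullet> u4 = 0)"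
proof -
  \<comment> \<open>\<open>c u\<close> is the component of \<open>u\<close> orthogonal to
    \<open>u1\<close>, scaled by the length of \<open>u1\<close>; \<open>prod\<close> expresses
    inner products in coordinates along and across \<open>u1\<close>.\<close>
  define c where "c u = u1 $ 1 * u $ 2 - u1 $ 2 * u $ 1" for u :: "real^2"
  have prod: "(u1 \<bullet> u) * (u1 \<bullet> w) + c u * c w = (u1 \<bullet> u1) * (u \<bullet> w)" for u w
    by (simp add: c_def inner_vec_def sum_2 algebra_simps)
  have le: "(u1 \<bullet> u) * (u1 \<bullet> w) + c u * c w \<le> 0" if "u \<bullet> w \<le> 0" for u w
    unfolding prod using that by (simp add: mult_nonneg_nonpos)
  have triple: False
    if neg: "u1 \<bullet> x < 0" "u1 \<bullet> y < 0" and "u1 \<bullet> z \<le> 0" "z \<noteq> 0" "x \<bullet> y \<le> 0" "x \<bullet> z \<le> 0" "y \<bullet> z \<le> 0" for x y z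
  proof -
    have "(u1 \<bullet> x) * (u1 \<bullet> y) > 0" using neg by (simp add: mult_neg_neg)
    then have xy: "c x * c y < 0" using le[OF that(5)] by linarith
    have "(u1 \<bullet> x) * (u1 \<bullet> z) \<ge> 0" "(u1 \<bullet> y) * (u1 \<bullet> z) \<ge> 0"
      using that by (auto simp: mult_nonpos_nonpos)
    then have xz: "c x * c z \<le> 0" "c y * c z \<le> 0" using le[OF that(6)] le[OF that(7)] by linarith+
    have "c z = 0"
      using xy xz by (auto simp: mult_less_0_iff mult_le_0_iff)
    then have "(u1 \<bullet> z) * (u1 \<bullet> z) = (u1 \<bullet> u1) * (z \<bullet> z)" using prod[of z z] by simp
    moreover have "(u1 \<bullet> u1) * (z \<bullet> z) > 0" using assms(1) that(4) by simp
    ultimately have "u1 \<bullet> z < 0" using that(3) by (cases "u1 \<bullet> z = 0") auto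
    then have "(u1 \<bullet> x) * (u1 \<bullet> z) > 0" using neg by (simp add: mult_neg_neg)
    then show False using le[OF that(6)] \<open>c z = 0\<close> by simp
  qed
  show ?thesis
    using triple[of u2 u3 u4] triple[of u2 u4 u3] triple[of u3 u4 u2] assms
    by (smt (verit) inner_commute)
qed

section \<open>Half-planes bounded by the bisector of two sites\<close>

lemma dist_le_iff_inner:
  fixes a z w :: "'a::real_inner"
  shows "dist a z \<le> dist a w \<longleftrightarrow> 2 * ((a - z) \<bullet> (w - z)) \<le> (w - z) \<bullet> (w - z)"
proof -
  have "dist a z \<le> dist a w \<longleftrightarrow> (dist a z)\<^sup>2 \<le> (dist a w)\<^sup>2"
    by (simp add: abs_le_square_iff[symmetric])
  also have "(dist a w)\<^sup>2 = (dist a z)\<^sup>2 - 2 * ((a - z) \<bullet> (w - z)) + (w - z) \<bullet> (w - z)"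
    by (simp add: dist_norm power2_norm_eq_inner inner_diff inner_commute algebra_simps)
  finally show ?thesis by linarith
qed

lemma dist_less_iff_inner:
  fixes a z w :: "'a::real_inner"
  shows "dist a z < dist a w \<longleftrightarrow> 2 * ((a - z) \<bullet> (w - z)) < (w - z) \<bullet> (w - z)"
proof -
  have "dist a z < dist a w \<longleftrightarrow> (dist a z)\<^sup>2 < (dist a w)\<^sup>2"
    by (metis zero_le_dist power_mono_iff pos2 not_le)
  also have "(dist a w)\<^sup>2 = (dist a z)\<^sup>2 - 2 * ((a - z) \<bullet> (w - z)) + (w - z) \<bullet> (w - z)"
    by (simp add: dist_norm power2_norm_eq_inner inner_diff inner_commute algebra_simps)
  finally show ?thesis by linarith
qed

text \<open>Twice the inner product with \<open>w - z\<close>, measured from \<open>z\<close>,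
  separates the segments at the value \<open>W\<close> of the bisector: it is at most
  \<open>W\<close> on the segment from \<open>z\<close> to \<open>a\<close>, with equality possible
  only at \<open>a\<close>, and at least \<open>W\<close> on the segment from \<open>b\<close> to
  \<open>w\<close>, with equality possible only at \<open>b\<close>.\<close>

lemma closest_site_segments_disjoint:
  fixes a b z w :: "'a::real_inner"
  assumes "dist a z \<le> dist a w" "dist b w \<le> dist b z" "z \<noteq> w" "a \<noteq> b"
  shows "closed_segment b w \<inter> closed_segment z a = {}"
proof (rule ccontr)
  assume "\<not> ?thesis"
  then obtain x where "x \<in> closed_segment b w" "x \<in> closed_segment z a" by blast
  then obtain m s where m: "0 \<le> m" "m \<le> 1" "x = (1 - m) *\<^sub>R b + m *\<^sub>R w"
    and s: "0 \<le> s" "s \<le> 1" "x = (1 - s) *\<^sub>R z + s *\<^sub>R a"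
    by (auto simp: in_segment)
  define W where "W = (w - z) \<bullet> (w - z)"
  have W: "W > 0" using assms(3) by (simp add: W_def)
  have a: "2 * ((a - z) \<bullet> (w - z)) \<le> W"
    using assms(1) by (simp add: dist_le_iff_inner W_def)
  have b: "W \<le> 2 * ((b - z) \<bullet> (w - z))"
    using assms(2) dist_less_iff_inner[of b z w] by (simp add: W_def not_less)
  have "x - z = (1 - m) *\<^sub>R (b - z) + m *\<^sub>R (w - z)"
    unfolding m(3) by (simp add: algebra_simps)
  moreover have "x - z = s *\<^sub>R (a - z)"
    unfolding s(3) by (simp add: algebra_simps)
  ultimately have xb: "2 * ((x - z) \<bullet> (w - z)) = (1 - m) * (2 * ((b - z) \<bullet> (w - z))) + 2 * m * W"
    and xa: "2 * ((x - z) \<bullet> (w - z)) = s * (2 * ((a - z) \<bullet> (w - z)))"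
    by (metis W_def distrib_left inner_add_left inner_scaleR_left mult.assoc mult.left_commute)
      (use \<open>x - z = s *\<^sub>R (a - z)\<close> in simp)
  have "(1 - m) * W \<le> (1 - m) * (2 * ((b - z) \<bullet> (w - z)))" using b m by (intro mult_left_mono) auto
  moreover have "s * (2 * ((a - z) \<bullet> (w - z))) \<le> s * W" using a s by (intro mult_left_mono) auto
  moreover have "s * W \<le> W" using s W by (simp add: mult_left_le_one_le)
  ultimately have "(1 - m) * W + 2 * m * W \<le> s * W" "m * W \<le> 0"
    using xa xb by (simp_all add: algebra_simps)
  then have "m \<le> 0" using W by (simp add: mult_le_0_iff)
  then have m0: "m = 0" using m by simp
  then have "1 \<le> s" using \<open>(1 - m) * W + 2 * m * W \<le> s * W\<close> W by simp
  then have "s = 1" using s by simp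
  then show False using m(3) s(3) m0 assms(4) by simp
qed

text \<open>Comparing \<open>x\<close> with both bisectors gives the two inequalities
  \<open>e\<close>. Unless \<open>G\<close> is negative, their left sides are at most 0, and adding
  the resulting bounds on \<open>s\<close> gives \<open>s = 1\<close> and \<open>l = 1 / 2\<close>:
  \<open>x\<close> is \<open>a\<close> and the midpoint of the two sites. For \<open>G > 0\<close>
  this contradicts \<open>e\<close>.\<close>

lemma site_segment_meets_spoke:
  fixes a z w w' :: "'a::real_inner"
  assumes x: "x \<in> closed_segment w w'" "x \<in> closed_segment z a"
    and a: "dist a z \<le> dist a w" "dist a z \<le> dist a w'" and neq: "z \<noteq> w" "z \<noteq> w'"
  shows "(w - z) \<bullet> (w' - z) \<le> 0"
    and "(w - z) \<bullet> (w' - z) = 0 \<Longrightarrow> 2 *\<^sub>R (a - z) = (w - z) + (w' - z)"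
proof -
  obtain l s where l: "0 \<le> l" "l \<le> 1" "x = (1 - l) *\<^sub>R w + l *\<^sub>R w'"
    and s: "0 \<le> s" "s \<le> 1" "x = (1 - s) *\<^sub>R z + s *\<^sub>R a"
    using x by (auto simp: in_segment)
  define W W' G where "W = (w - z) \<bullet> (w - z)" and "W' = (w' - z) \<bullet> (w' - z)" and "G = (w - z) \<bullet> (w' - z)"
  have W: "W > 0" "W' > 0" using neq by (auto simp: W_def W'_def)
  have aw: "2 * ((a - z) \<bullet> (w - z)) \<le> W" "2 * ((a - z) \<bullet> (w' - z)) \<le> W'"
    using a by (simp_all add: dist_le_iff_inner W_def W'_def)
  have xz: "x - z = (1 - l) *\<^sub>R (w - z) + l *\<^sub>R (w' - z)"
    unfolding l(3) by (simp add: algebra_simps)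
  have xz': "x - z = s *\<^sub>R (a - z)"
    unfolding s(3) by (simp add: algebra_simps)
  have "2 * ((x - z) \<bullet> (w - z)) \<le> s * W" "2 * ((x - z) \<bullet> (w' - z)) \<le> s * W'"
    unfolding xz' using mult_left_mono[OF aw(1) s(1)] mult_left_mono[OF aw(2) s(1)] by (simp_all add: mult_ac)
  then have "2 * ((1 - l) * W + l * G) \<le> s * W" "2 * ((1 - l) * G + l * W') \<le> s * W'"
    unfolding xz by (simp_all add: inner_add_left W_def W'_def G_def inner_commute[of "w' - z" "w - z"])
  then have e: "(2 - 2 * l - s) * W \<le> - 2 * l * G" "(2 * l - s) * W' \<le> - 2 * (1 - l) * G"
    by (simp_all add: algebra_simps)
  show le: "(w - z) \<bullet> (w' - z) \<le> 0"
  proof (rule ccontr)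
    assume "\<not> ?thesis"
    then have G: "G > 0" by (simp add: G_def)
    have "(2 - 2 * l - s) * W \<le> 0" "(2 * l - s) * W' \<le> 0"
      using e mult_nonneg_nonneg[of l G] mult_nonneg_nonneg[of "1 - l" G] l G by linarith+
    then have "2 - 2 * l - s \<le> 0" "2 * l - s \<le> 0" using W by (auto simp: mult_le_0_iff)
    then have "s = 1" "l = 1 / 2" using s by linarith+
    then show False using e(1) G unfolding \<open>s = 1\<close> \<open>l = 1 / 2\<close> by simp
  qed
  assume "(w - z) \<bullet> (w' - z) = 0"
  then have "(2 - 2 * l - s) * W \<le> 0" "(2 * l - s) * W' \<le> 0" using e by (auto simp: G_def)
  then have "2 - 2 * l - s \<le> 0" "2 * l - s \<le> 0" using W by (auto simp: mult_le_0_iff)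
  then have "s = 1" "l = 1 / 2" using s by linarith+
  then have "a - z = (1 / 2) *\<^sub>R ((w - z) + (w' - z))" using xz xz' unfolding \<open>s = 1\<close> \<open>l = 1 / 2\<close> by (simp add: scaleR_add_right)
  then show "2 *\<^sub>R (a - z) = (w - z) + (w' - z)" by simp
qed

text \<open>\<open>a\<close> and \<open>a'\<close> are on the side of \<open>z\<close> of the
  bisector and \<open>b\<close> is on the side of \<open>w\<close>. If \<open>b\<close> is strictly
  between them, \<open>a\<close> and \<open>b\<close> are forced onto the bisector, so
  \<open>b - a\<close> is orthogonal to \<open>w - z\<close>; this is impossible for nonzero vectors
  on one line.\<close>

lemma collinear_closest_site_between:
  fixes a a' b z w :: "real^2"
  assumes "dist a z \<le> dist a w" "dist a' z \<le> dist a' w" "dist b w \<le> dist b z" "z \<noteq> w"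
    and "b \<in> closed_segment a a'" "collinear {a, b, z, w}"
  shows "b = a \<or> b = a'"
proof (rule ccontr)
  assume neq: "\<not> ?thesis"
  obtain m where m: "0 \<le> m" "m \<le> 1" "b = (1 - m) *\<^sub>R a + m *\<^sub>R a'" using assms(5) by (auto simp: in_segment)
  have "m \<noteq> 0" "m \<noteq> 1" using m(3) neq by auto
  then have m': "0 < m" "m < 1" using m by auto
  define W where "W = (w - z) \<bullet> (w - z)"
  have W: "2 * ((a - z) \<bullet> (w - z)) \<le> W" "2 * ((a' - z) \<bullet> (w - z)) \<le> W" "W \<le> 2 * ((b - z) \<bullet> (w - z))"
    using assms(1,2,3) dist_less_iff_inner[of b z w] dist_le_iff_inner[of a z w] dist_le_iff_inner[of a' z w]
    by (simp_all add: W_def not_less)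
  have "b - z = (1 - m) *\<^sub>R (a - z) + m *\<^sub>R (a' - z)" using m(3) by (simp add: algebra_simps)
  then have "2 * ((b - z) \<bullet> (w - z)) = (1 - m) * (2 * ((a - z) \<bullet> (w - z))) + m * (2 * ((a' - z) \<bullet> (w - z)))"
    by (simp add: inner_add_left)
  moreover have "m * (2 * ((a' - z) \<bullet> (w - z))) \<le> m * W" using W m by (intro mult_left_mono) auto
  ultimately have "(1 - m) * W \<le> (1 - m) * (2 * ((a - z) \<bullet> (w - z)))"
    using W(3) by (simp add: algebra_simps)
  then have aW: "2 * ((a - z) \<bullet> (w - z)) = W" using m' W(1) by simp
  have "(1 - m) * (2 * ((a - z) \<bullet> (w - z))) \<le> (1 - m) * W" using W m by (intro mult_left_mono) auto
  then have "2 * ((b - z) \<bullet> (w - z)) = W"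
    using W(3) \<open>2 * ((b - z) \<bullet> (w - z)) = _\<close> \<open>m * (2 * ((a' - z) \<bullet> (w - z))) \<le> m * W\<close>
    by (simp add: algebra_simps)
  then have orth: "(b - a) \<bullet> (w - z) = 0" using aW by (simp add: inner_diff_left)
  obtain u where u: "\<forall>x\<in>{a, b, z, w}. \<forall>y\<in>{a, b, z, w}. \<exists>c. x - y = c *\<^sub>R u"
    using assms(6) unfolding collinear_def by blast
  obtain c where c: "b - a = c *\<^sub>R u" using u by blast
  obtain c' where c': "w - z = c' *\<^sub>R u" using u by blast
  have "b - a \<noteq> 0" "w - z \<noteq> 0" using neq assms(4) by auto
  then show False using orth unfolding c c' by auto
qed

section \<open>Cyclic subsequences and runs\<close>

definition cyclic_subseq :: "'a list \<Rightarrow> 'a list \<Rightarrow> bool" where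
  "cyclic_subseq zs xs \<longleftrightarrow> (\<exists>k. subseq zs (rotate k xs))"

lemma cyclic_subseq_mono: "cyclic_subseq zs xs \<Longrightarrow> subseq zs' zs \<Longrightarrow> cyclic_subseq zs' xs"
  unfolding cyclic_subseq_def using subseq_order.order_trans by blast

lemma cyclic_subseq_set: "cyclic_subseq zs xs \<Longrightarrow> set zs \<subseteq> set xs"
  unfolding cyclic_subseq_def subseq_conv_nths by (metis set_nths_subset set_rotate)

text \<open>The cut of \<open>ys\<close> splits an embedded \<open>zs\<close> as well, and both
  lists exchange their two parts.\<close>

lemma subseq_rotate:
  assumes "subseq zs ys"
  shows "\<exists>j. subseq (rotate j zs) (rotate k ys)"
proof -
  define m where "m = k mod length ys"
  have "subseq zs (take m ys @ drop m ys)" using assms by simp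
  then obtain us vs where uv: "zs = us @ vs" "subseq us (take m ys)" "subseq vs (drop m ys)"
    using subseq_appendE by blast
  then have "subseq (vs @ us) (drop m ys @ take m ys)" by (simp add: list_emb_append_mono)
  moreover have "rotate (length us) zs = vs @ us" by (simp add: uv(1) rotate_append)
  moreover have "rotate k ys = drop m ys @ take m ys" by (simp add: rotate_drop_take m_def)
  ultimately show ?thesis by metis
qed

text \<open>Any starting point of the cycle serves, provided that \<open>zs\<close> is rotated
  along.\<close>

lemma cyclic_subseq_rotate:
  assumes "cyclic_subseq zs xs"
  shows "\<exists>j. subseq (rotate j zs) (rotate k xs)"
proof -
  obtain m where "subseq zs (rotate m xs)" using assms by (auto simp: cyclic_subseq_def)
  \<comment> \<open>The added amount completes the rotation by \<open>m\<close> to full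
    turns.\<close>
  then obtain j where j: "subseq (rotate j zs) (rotate (k + (length xs - m mod length xs)) (rotate m xs))"
    using subseq_rotate by blast
  have "rotate (length xs - m mod length xs) (rotate m xs) = xs"
  proof (cases "xs = []")
    case False
    have "(length xs - m mod length xs + m) mod length xs = 0"
      using False by (metis add.commute le_add_diff_inverse mod_add_left_eq mod_le_divisor length_greater_0_conv mod_self)
    then show ?thesis by (simp only: rotate_rotate rotate_id)
  qed simp
  then have "rotate (k + (length xs - m mod length xs)) (rotate m xs) = rotate k xs"
    by (metis rotate_rotate)
  then show ?thesis using j by auto
qed

section \<open>Alternating lists and runs\<close>

fun alternating :: "('a \<Rightarrow> bool) \<Rightarrow> bool \<Rightarrow> 'a list \<Rightarrow> bool" where
  "alternating Q b [] \<longleftrightarrow> True"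
| "alternating Q b (x # xs) \<longleftrightarrow> Q x = b \<and> alternating Q (\<not> b) xs"

lemma alternating_append:
  "alternating Q b (xs @ ys) \<longleftrightarrow>
     alternating Q b xs \<and> alternating Q (if even (length xs) then b else \<not> b) ys"
  by (induction Q b xs rule: alternating.induct) auto

text \<open>With even length the last element and the first differ under \<open>Q\<close>, so the
  list closes up to an alternating cycle; the cut only decides the first value.\<close>

lemma alternating_rotate:
  assumes "alternating Q b zs" "even (length zs)"
  shows "\<exists>b'. alternating Q b' (rotate j zs)"
proof -
  define m where "m = j mod length zs"
  have "alternating Q b (take m zs @ drop m zs)" using assms by simp
  then have *: "alternating Q b (take m zs)"
    "alternating Q (if even (length (take m zs)) then b else \<not> b) (drop m zs)"
    unfolding alternating_append by auto
  have "even (length (take m zs)) \<longleftrightarrow> even (length (drop m zs))"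
    using assms(2) by (metis append_take_drop_id even_add length_append)
  then have "alternating Q (if even (length (take m zs)) then b else \<not> b) (drop m zs @ take m zs)"
    unfolding alternating_append using * by auto
  then show ?thesis by (auto simp: rotate_drop_take m_def)
qed

text \<open>Greedy: split off the first maximal run of \<open>Q\<close>. One element of it and the
  element \<open>h\<close> that ends it extend an alternating list of the rest by two, so the rest
  satisfies the hypothesis for one run less.\<close>

lemma partition_into_runs:
  assumes "distinct ys" "\<nexists>zs. length zs = Suc (2 * n) \<and> subseq zs ys \<and> alternating Q True zs"
  shows "\<exists>P. partition_on {x \<in> set ys. Q x} P \<and> finite P \<and> card P \<le> n \<and>
             (\<forall>B\<in>P. \<exists>us. sublist us ys \<and> B = set us)"
  using assms
proof (induction n arbitrary: ys)
  case 0
  have "\<not> Q x" if "x \<in> set ys" for x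
  proof
    assume "Q x"
    then have "length [x] = Suc (2 * 0) \<and> subseq [x] ys \<and> alternating Q True [x]"
      using that by (simp add: subseq_singleton_left)
    then show False using 0(2) by blast
  qed
  then have "partition_on {x \<in> set ys. Q x} {}" by (auto simp: partition_on_def)
  then show ?case by (intro exI[of _ "{}"]) simp
next
  case (Suc n)
  define us where "us = takeWhile (\<lambda>x. \<not> Q x) ys"
  define vs where "vs = dropWhile (\<lambda>x. \<not> Q x) ys"
  define rs where "rs = takeWhile Q vs"
  define ts where "ts = dropWhile Q vs"
  have ys: "ys = us @ rs @ ts" by (simp add: us_def vs_def rs_def ts_def)
  have us: "\<not> Q x" if "x \<in> set us" for x using that by (auto simp: us_def dest: set_takeWhileD)
  have rs: "Q x" if "x \<in> set rs" for x using that by (auto simp: rs_def dest: set_takeWhileD)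
  show ?case
  proof (cases "vs = []")
    case True
    then have "rs = []" "ts = []" by (auto simp: rs_def ts_def)
    then have "partition_on {x \<in> set ys. Q x} {}" using us ys by (auto simp: partition_on_def)
    then show ?thesis by (intro exI[of _ "{}"]) simp
  next
    case False
    then have "Q (hd vs)" using hd_dropWhile[of "\<lambda>x. \<not> Q x" ys] by (simp add: vs_def)
    then obtain r rs' where r: "rs = r # rs'" using False unfolding rs_def by (cases vs) auto
    have "\<nexists>zs. length zs = Suc (2 * n) \<and> subseq zs ts \<and> alternating Q True zs"
    proof
      assume "\<exists>zs. length zs = Suc (2 * n) \<and> subseq zs ts \<and> alternating Q True zs"
      then obtain z zs where z: "length (z # zs) = Suc (2 * n)" "subseq (z # zs) ts" "alternating Q True (z # zs)"
        by (metis Suc_length_conv)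
      then obtain h ts' where h: "ts = h # ts'" by (cases ts) auto
      have "\<not> Q h" using h hd_dropWhile[of Q vs] by (simp flip: ts_def)
      then have "z \<noteq> h" using z(3) by auto
      then have "subseq (z # zs) ts'" using z(2) h by (auto simp: subseq_Cons2_neq)
      then have "subseq (r # h # z # zs) ys"
        unfolding ys r h using list_emb_append2[of "(=)"] by auto
      moreover have "alternating Q True (r # h # z # zs)" using z(3) \<open>\<not> Q h\<close> rs r by auto
      moreover have "length (r # h # z # zs) = Suc (2 * Suc n)" using z(1) by simp
      ultimately show False using Suc.prems(2) by blast
    qed
    moreover have "distinct ts" using Suc.prems(1) ys by simp
    ultimately obtain P where P: "partition_on {x \<in> set ts. Q x} P" "finite P" "card P \<le> n"
      "\<forall>B\<in>P. \<exists>us. sublist us ts \<and> B = set us"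
      using Suc.IH by blast
    have "{x \<in> set ys. Q x} = set rs \<union> {x \<in> set ts. Q x}" using us rs ys by auto
    moreover have "set rs \<inter> {x \<in> set ts. Q x} = {}" using Suc.prems(1) ys by auto
    ultimately have "partition_on {x \<in> set ys. Q x} (insert (set rs) P)"
      using P(1) r unfolding partition_on_def disjoint_def by auto
    moreover have "card (insert (set rs) P) \<le> Suc n" using P by (simp add: card_insert_if)
    moreover have "\<exists>us. sublist us ys \<and> B = set us" if B: "B \<in> insert (set rs) P" for B
    proof (cases "B = set rs")
      case True
      moreover have "sublist rs ys" unfolding ys by (auto simp: sublist_def)
      ultimately show ?thesis by blast
    next
      case False
      then obtain ws where "sublist ws ts" "B = set ws" using B P(4) by blast
      moreover have "sublist ts ys" unfolding ys sublist_def by (intro exI[of _ "us @ rs"] exI[of _ "[]"]) simp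
      ultimately show ?thesis using sublist_order.order_trans by blast
    qed
    ultimately show ?thesis using P(2) by (intro exI[of _ "insert (set rs) P"]) auto
  qed
qed

text \<open>\<open>zs\<close> shows \<open>n + 1\<close> linear runs, beginning and ending in
  \<open>Q\<close>. An end of \<open>ys\<close> outside \<open>Q\<close> separates the last of them
  from the first, which makes them \<open>n + 1\<close> cyclic runs.\<close>

lemma alternating_cyclic_closure:
  assumes "subseq zs ys" "alternating Q True zs" "length zs = Suc (2 * n)" "\<not> Q (hd ys) \<or> \<not> Q (last ys)"
  shows "\<exists>zs' b. subseq zs' ys \<and> alternating Q b zs' \<and> length zs' = 2 * Suc n"
proof (cases "Q (hd ys)")
  case False
  obtain y ys' where y: "ys = y # ys'" using assms(1,3) by (cases ys) auto
  obtain z zs0 where z: "zs = z # zs0" using assms(3) by (cases zs) auto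
  have "z \<noteq> y" using False assms(2) y z by auto
  then have "subseq (y # zs) ys" using assms(1) y z by (auto simp: subseq_Cons2_neq)
  moreover have "alternating Q False (y # zs)" using False y assms(2) by simp
  ultimately show ?thesis using assms(3) by fastforce
next
  case True
  then have nl: "\<not> Q (last ys)" using assms(4) by blast
  have "ys \<noteq> []" using assms(1,3) by auto
  then obtain ys' y where y: "ys = ys' @ [y]" by (metis append_butlast_last_id)
  have alt: "alternating Q True (butlast zs @ [last zs])"
    using assms(2,3) by (metis append_butlast_last_id length_0_conv nat.distinct(1))
  then have "Q (last zs)" using assms(3) unfolding alternating_append by simp
  then have "last zs \<noteq> y" using nl y by auto
  obtain us vs where uv: "zs = us @ vs" "subseq us ys'" "subseq vs [y]"
    using assms(1) y subseq_appendE by blast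
  have "vs = []"
  proof (rule ccontr)
    assume "vs \<noteq> []"
    then have "last vs = y" using uv(3) by (cases vs) (auto split: if_splits)
    then show False using uv(1) \<open>vs \<noteq> []\<close> \<open>last zs \<noteq> y\<close> by simp
  qed
  then have "subseq (zs @ [y]) ys" using uv y by (simp add: list_emb_append_mono)
  moreover have "alternating Q True (zs @ [y])"
    unfolding alternating_append using assms(2,3) nl y by simp
  ultimately show ?thesis using assms(3) by fastforce
qed

text \<open>Start the cycle at \<open>a\<close>. If the rotated list begins in \<open>Q\<close>,
  then \<open>a\<close> takes the place of its first element; otherwise \<open>a\<close> is put in
  front and the last element, which is in \<open>Q\<close>, is dropped.\<close>

lemma alternating_cyclic_subseq_through:
  assumes "cyclic_subseq zs xs" "alternating Q b zs" "length zs = 2 * Suc n" "a \<in> set xs" "Q a"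
  shows "\<exists>zs'. cyclic_subseq (a # zs') xs \<and> alternating Q True (a # zs') \<and> length (a # zs') = length zs"
proof -
  obtain us ws where "xs = us @ a # ws" using assms(4) split_list by metis
  then have rot: "rotate (length us) xs = a # (ws @ us)" by (simp add: rotate_append)
  obtain j where j: "subseq (rotate j zs) (a # (ws @ us))"
    using cyclic_subseq_rotate[OF assms(1), of "length us"] rot by auto
  obtain b' where b': "alternating Q b' (rotate j zs)"
    using alternating_rotate[OF assms(2)] assms(3) by auto
  obtain c cs where c: "rotate j zs = c # cs"
    using assms(3) by (cases "rotate j zs") auto
  have len: "length (c # cs) = length zs" using c by (metis length_rotate)
  show ?thesis
  proof (cases "Q c")
    case True
    have "subseq cs (ws @ us)"
      using j c by (cases "c = a") (auto dest: subseq_Cons')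
    then have "subseq (a # cs) (a # (ws @ us))" by simp
    then have "cyclic_subseq (a # cs) xs" unfolding cyclic_subseq_def rot[symmetric] by blast
    moreover have "alternating Q True (a # cs)" using b' c True assms(5) by (cases b') auto
    ultimately show ?thesis using len by auto
  next
    case False
    then have "c \<noteq> a" using assms(5) by auto
    then have "subseq (c # cs) (ws @ us)" using j c by (simp add: subseq_Cons2_neq)
    moreover have "subseq (butlast (c # cs)) (c # cs)" by (metis prefix_imp_subseq prefixeq_butlast)
    ultimately have "subseq (a # butlast (c # cs)) (a # (ws @ us))"
      using subseq_order.order_trans by auto
    then have "cyclic_subseq (a # butlast (c # cs)) xs" unfolding cyclic_subseq_def rot[symmetric] by blast
    moreover have "alternating Q False (butlast (c # cs) @ [last (c # cs)])"
      using b' c False by (metis alternating.simps(2) append_butlast_last_id list.distinct(1))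
    then have "alternating Q True (a # butlast (c # cs))"
      unfolding alternating_append using assms(5) by simp
    ultimately show ?thesis using len by (intro exI[of _ "butlast (c # cs)"]) auto
  qed
qed

text \<open>Some neighbours \<open>x\<close>, \<open>y\<close> in the list have different values;
  the rotation that starts at \<open>y\<close> ends with \<open>x\<close>.\<close>

lemma rotate_between_unequal:
  assumes "s \<in> set xs" "s' \<in> set xs" "f s \<noteq> f s'"
  shows "\<exists>k. f (hd (rotate k xs)) \<noteq> f (last (rotate k xs))"
proof -
  have "\<exists>us x y ws. xs = us @ x # y # ws \<and> f x \<noteq> f y" if "\<exists>s\<in>set xs. f s \<noteq> f (hd xs)"
    using that
  proof (induction xs)
    case (Cons x xs)
    then obtain y ws where xs: "xs = y # ws" by (cases xs) auto
    show ?case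
    proof (cases "f x = f y")
      case True
      then have "\<exists>s\<in>set xs. f s \<noteq> f (hd xs)" using Cons.prems xs by auto
      then obtain us x' y' ws' where "xs = us @ x' # y' # ws'" "f x' \<noteq> f y'" using Cons.IH by blast
      then show ?thesis by (intro exI[of _ "x # us"]) auto
    next
      case False
      then show ?thesis using xs by (intro exI[of _ "[]"]) auto
    qed
  qed simp
  moreover have "\<exists>s\<in>set xs. f s \<noteq> f (hd xs)" using assms by metis
  ultimately obtain us x y ws where xs: "xs = us @ x # y # ws" "f x \<noteq> f y" by blast
  have "rotate (length (us @ [x])) ((us @ [x]) @ y # ws) = (y # ws) @ us @ [x]" by (rule rotate_append)
  then have "rotate (Suc (length us)) xs = y # ws @ us @ [x]" using xs by simp
  then show ?thesis using xs(2) by (intro exI[of _ "Suc (length us)"]) simp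
qed

section \<open>At most three cyclic runs\<close>

text \<open>The geometry behind \<open>ccw_source_order\<close>, separated from layouts: \<tau> is
  the time at which the walk meets a source, and sites enter later as points of
  \<open>H\<close>.\<close>

locale sources_on_boundary =
  fixes H :: "(real^2) set" and vs :: "(real^2) list" and xs :: "'s list"
    and p :: "'s \<Rightarrow> real^2" and \<tau> :: "'s \<Rightarrow> real"
  assumes compact_H: "compact H" and convex_H: "convex H" and corners: "ccw_corners H vs"
    and \<tau>_range: "s \<in> set xs \<Longrightarrow> \<tau> s \<in> {0..<real (length vs)}"
    and walk_\<tau>: "s \<in> set xs \<Longrightarrow> boundary_walk vs (\<tau> s) = p s"
    and sorted_\<tau>: "sorted (map \<tau> xs)"
begin

lemma subseq_sorted:
  assumes "subseq zs xs"
  shows "sorted (map \<tau> zs)" "set zs \<subseteq> set xs"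
proof -
  obtain N where "zs = nths xs N" using assms by (auto simp: subseq_conv_nths)
  then show "sorted (map \<tau> zs)" "set zs \<subseteq> set xs"
    using sorted_nths[OF sorted_\<tau>] by (auto simp: nths_map set_nths_subset dest: in_set_nthsD)
qed

lemma source_in_hull:
  assumes "s \<in> set xs"
  shows "p s \<in> H"
proof -
  obtain i f where i: "i < length vs" "0 \<le> f" "f < 1" "Suc i mod length vs < length vs"
    and w: "boundary_walk vs (\<tau> s) = (1 - f) *\<^sub>R vs ! i + f *\<^sub>R vs ! (Suc i mod length vs)"
    using boundary_walk_segment[OF \<tau>_range[OF assms]] by metis
  have "vs ! i \<in> H" "vs ! (Suc i mod length vs) \<in> H"
    using i nth_mem corners unfolding ccw_corners_def extreme_point_of_def by blast+
  then show ?thesis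
    using convexD[OF convex_H, of "vs ! i" "vs ! (Suc i mod length vs)" "1 - f" f] i w walk_\<tau>[OF assms] by simp
qed

lemma connected_meets_spokes_linear:
  assumes "interior H \<noteq> {}" "z \<in> H" "connected \<Gamma>" "compact \<Gamma>" "\<Gamma> \<subseteq> H" "p b \<in> \<Gamma>" "p b' \<in> \<Gamma>"
    and "{a, a', b, b'} \<subseteq> set xs" "\<tau> b < \<tau> a'" "\<tau> a' < \<tau> b'" "\<tau> a \<notin> {\<tau> b..\<tau> b'}"
  shows "\<Gamma> \<inter> (closed_segment z (p a) \<union> closed_segment z (p a')) \<noteq> {}"
proof -
  have range: "\<tau> s \<in> {0..<real (length vs)}" if "s \<in> {a, a', b, b'}" for s
    using \<tau>_range assms(8) that by blast
  then have sub: "insert (\<tau> a) {\<tau> b..\<tau> b'} \<subseteq> {0..<real (length vs)}"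
    by (smt (verit, ccfv_threshold) atLeastAtMost_iff atLeastLessThan_iff insertE insert_iff subsetI)
  have "\<Gamma> \<inter> (closed_segment z (boundary_walk vs (\<tau> a)) \<union> closed_segment z (boundary_walk vs (\<tau> a'))) \<noteq> {}"
  proof (rule connected_meets_radial_segment_closed[OF convex_H assms(1,2)])
    show "continuous_on {\<tau> b..\<tau> b'} (boundary_walk vs)"
      using range by (intro continuous_on_boundary_walk) auto
    show "inj_on (boundary_walk vs) (insert (\<tau> a) {\<tau> b..\<tau> b'})"
      using inj_on_boundary_walk[OF corners compact_H convex_H assms(1)] sub inj_on_subset by blast
    show "boundary_walk vs ` insert (\<tau> a) {\<tau> b..\<tau> b'} \<subseteq> frontier H"
      using boundary_walk_frontier[OF corners compact_H convex_H assms(1)] sub by blast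
    show "boundary_walk vs (\<tau> b) \<in> \<Gamma>" "boundary_walk vs (\<tau> b') \<in> \<Gamma>"
      using assms(6-8) walk_\<tau> by auto
  qed (use assms in auto)
  then show ?thesis using assms(8) walk_\<tau> by auto
qed

text \<open>A rotation brings the four sources into the order of the list. Whichever of them comes
  first, exactly one of \<open>a\<close>, \<open>a'\<close> is met in time between \<open>b\<close>
  and \<open>b'\<close>; the disjointness of positions makes the relevant inequalities of times
  strict.\<close>

lemma connected_meets_spokes:
  assumes "interior H \<noteq> {}" "z \<in> H" "connected \<Gamma>" "compact \<Gamma>" "\<Gamma> \<subseteq> H" "p b \<in> \<Gamma>" "p b' \<in> \<Gamma>"
    and "cyclic_subseq [a, b, a', b'] xs" and "{p a, p a'} \<inter> {p b, p b'} = {}"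
  shows "\<Gamma> \<inter> (closed_segment z (p a) \<union> closed_segment z (p a')) \<noteq> {}"
proof -
  obtain j where j: "subseq (rotate j [a, b, a', b']) xs"
    using cyclic_subseq_rotate[OF assms(8), of 0] by auto
  define zs where "zs = rotate j [a, b, a', b']"
  have zs: "sorted (map \<tau> zs)" "set zs \<subseteq> set xs" using subseq_sorted[OF j] by (auto simp: zs_def)
  have sub: "{a, a', b, b'} \<subseteq> set xs" using zs(2) by (auto simp: zs_def)
  have neq: "\<tau> a \<noteq> \<tau> b" "\<tau> a \<noteq> \<tau> b'" "\<tau> a' \<noteq> \<tau> b" "\<tau> a' \<noteq> \<tau> b'"
  proof -
    have "\<tau> s \<noteq> \<tau> s'" if "p s \<noteq> p s'" "s \<in> set xs" "s' \<in> set xs" for s s'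
      using walk_\<tau>[OF that(2)] walk_\<tau>[OF that(3)] that(1) by metis
    then show "\<tau> a \<noteq> \<tau> b" "\<tau> a \<noteq> \<tau> b'" "\<tau> a' \<noteq> \<tau> b" "\<tau> a' \<noteq> \<tau> b'"
      using assms(9) sub by auto
  qed
  have "j mod 4 < 4" by simp
  then consider "j mod 4 = 0" | "j mod 4 = 1" | "j mod 4 = 2" | "j mod 4 = 3" by linarith
  then have "zs = [a, b, a', b'] \<or> zs = [b, a', b', a] \<or> zs = [a', b', a, b] \<or> zs = [b', a, b, a']"
    unfolding zs_def by cases (simp_all add: rotate_drop_take)
  then consider "\<tau> b < \<tau> a'" "\<tau> a' < \<tau> b'" "\<tau> a \<notin> {\<tau> b..\<tau> b'}"
    | "\<tau> b' < \<tau> a" "\<tau> a < \<tau> b" "\<tau> a' \<notin> {\<tau> b'..\<tau> b}"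
    using zs(1) neq by fastforce
  then show ?thesis
  proof cases
    case 1
    then show ?thesis using connected_meets_spokes_linear[OF assms(1-7) sub] by blast
  next
    case 2
    then show ?thesis
      using connected_meets_spokes_linear[OF assms(1-5) assms(7,6), of a' a] sub by auto
  qed
qed

text \<open>The case \<open>w = w'\<close> is included: the first claim is then absurd, so sources
  separated by \<open>a\<close> and \<open>a'\<close> in this way belong to different sites.\<close>

lemma alternating_sites_obtuse:
  assumes int: "interior H \<noteq> {}" and H: "z \<in> H" "w \<in> H" "w' \<in> H" and neq: "z \<noteq> w" "z \<noteq> w'"
    and cyc: "cyclic_subseq [a, b, a', b'] xs" and disj: "{p a, p a'} \<inter> {p b, p b'} = {}"
    and a: "\<And>u. u \<in> {w, w'} \<Longrightarrow> dist (p a) z \<le> dist (p a) u"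
    and a': "\<And>u. u \<in> {w, w'} \<Longrightarrow> dist (p a') z \<le> dist (p a') u"
    and b: "dist (p b) w \<le> dist (p b) z" "dist (p b') w' \<le> dist (p b') z"
  shows "(w - z) \<bullet> (w' - z) \<le> 0"
    and "dist (p a) z < dist (p a) w \<Longrightarrow> (w - z) \<bullet> (w' - z) = 0 \<Longrightarrow> 2 *\<^sub>R (p a' - z) = (w - z) + (w' - z)"
proof -
  define \<Gamma> where "\<Gamma> = closed_segment (p b) w \<union> closed_segment w w' \<union> closed_segment (p b') w'"
  have "p b \<in> H" "p b' \<in> H"
    using cyclic_subseq_set[OF cyc] source_in_hull by auto
  then have "\<Gamma> \<subseteq> H" using H convex_H by (simp add: \<Gamma>_def closed_segment_subset)
  moreover have "connected \<Gamma>"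
    unfolding \<Gamma>_def by (intro connected_Un) auto
  moreover have "compact \<Gamma>" unfolding \<Gamma>_def by (intro compact_Un) auto
  ultimately have "\<Gamma> \<inter> (closed_segment z (p a) \<union> closed_segment z (p a')) \<noteq> {}"
    using connected_meets_spokes[OF int H(1) _ _ _ _ _ cyc disj] by (auto simp: \<Gamma>_def)
  then obtain x c where c: "c \<in> {a, a'}" and x: "x \<in> \<Gamma>" "x \<in> closed_segment z (p c)" by blast
  have "closed_segment (p b) w \<inter> closed_segment z (p c) = {}"
    using a a' b neq disj c by (intro closest_site_segments_disjoint) auto
  moreover have "closed_segment (p b') w' \<inter> closed_segment z (p c) = {}"
    using a a' b neq disj c by (intro closest_site_segments_disjoint) auto
  ultimately have xw: "x \<in> closed_segment w w'" using x by (auto simp: \<Gamma>_def)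
  have cz: "dist (p c) z \<le> dist (p c) w" "dist (p c) z \<le> dist (p c) w'" using a a' c by auto
  show "(w - z) \<bullet> (w' - z) \<le> 0"
    using site_segment_meets_spoke(1)[OF xw x(2) cz neq] .
  assume strict: "dist (p a) z < dist (p a) w" and orth: "(w - z) \<bullet> (w' - z) = 0"
  have mid: "2 *\<^sub>R (p c - z) = (w - z) + (w' - z)"
    using site_segment_meets_spoke(2)[OF xw x(2) cz neq orth] .
  \<comment> \<open>If the spoke of \<open>a\<close> were the one met, the midpoint equation would
    put \<open>a\<close> on the bisector of \<open>z\<close> and \<open>w\<close>, against
    \<open>strict\<close>.\<close>
  have "c \<noteq> a"
  proof
    assume "c = a"
    have "(2 *\<^sub>R (p c - z)) \<bullet> (w - z) = (w - z) \<bullet> (w - z)"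
      unfolding mid inner_add_left using orth inner_commute[of "w' - z" "w - z"] by simp
    then show False using strict \<open>c = a\<close> by (simp add: dist_less_iff_inner)
  qed
  then show "2 *\<^sub>R (p a' - z) = (w - z) + (w' - z)" using mid c by auto
qed

section \<open>Flat hulls\<close>

lemma same_edge_between:
  assumes "{a, b, c} \<subseteq> set xs" "\<tau> a \<le> \<tau> b" "\<tau> b \<le> \<tau> c" "\<lfloor>\<tau> a\<rfloor> = \<lfloor>\<tau> c\<rfloor>"
  shows "p b \<in> closed_segment (p a) (p c)"
proof -
  define u where "u = vs ! nat \<lfloor>\<tau> a\<rfloor>"
  define v where "v = vs ! (Suc (nat \<lfloor>\<tau> a\<rfloor>) mod length vs)"
  have "\<lfloor>\<tau> b\<rfloor> = \<lfloor>\<tau> a\<rfloor>" using assms(2-4) floor_mono by (metis order_antisym)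
  then have walk: "p s = (1 - frac (\<tau> s)) *\<^sub>R u + frac (\<tau> s) *\<^sub>R v" if "s \<in> {a, b, c}" for s
    using that walk_\<tau>[of s] assms(1,4) by (auto simp: boundary_walk_def Let_def u_def v_def)
  have le: "frac (\<tau> a) \<le> frac (\<tau> b)" "frac (\<tau> b) \<le> frac (\<tau> c)"
    using assms(2-4) \<open>\<lfloor>\<tau> b\<rfloor> = \<lfloor>\<tau> a\<rfloor>\<close> by (auto simp: frac_def)
  show ?thesis
  proof (cases "frac (\<tau> a) = frac (\<tau> c)")
    case True
    then have "p b = p a" using le walk by auto
    then show ?thesis by simp
  next
    case False
    \<comment> \<open>The walk is affine on the edge, so the relative time of \<open>b\<close>
      between \<open>a\<close> and \<open>c\<close> is its parameter on the segment.\<close>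
    define k where "k = (frac (\<tau> b) - frac (\<tau> a)) / (frac (\<tau> c) - frac (\<tau> a))"
    have k: "0 \<le> k" "k \<le> 1" using le False by (auto simp: k_def)
    have "k * (frac (\<tau> c) - frac (\<tau> a)) = frac (\<tau> b) - frac (\<tau> a)" using False by (simp add: k_def)
    then have fb: "frac (\<tau> b) = (1 - k) * frac (\<tau> a) + k * frac (\<tau> c)" by (simp add: algebra_simps)
    have "p b = (1 - k) *\<^sub>R p a + k *\<^sub>R p c"
      unfolding walk[of a, simplified] walk[of b, simplified] walk[of c, simplified] fb
      by (simp add: algebra_simps)
    then show ?thesis using k by (auto simp: in_segment)
  qed
qed

text \<open>The walk runs along a segment at most there and back, so four consecutive ones of the
  eight sources are met on one edge. Three of these are attached to \<open>z\<close>, to another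
  site and to \<open>z\<close> again, which \<open>no\<close> excludes.\<close>

lemma flat_no_alternation:
  assumes flat: "interior H = {}" and sites: "Z \<subseteq> H" "z \<in> Z"
    and \<nu>: "\<And>x. \<nu> x \<in> Z" "\<And>x w. w \<in> Z \<Longrightarrow> dist x (\<nu> x) \<le> dist x w"
    and zs: "cyclic_subseq zs xs" "alternating (\<lambda>s. \<nu> (p s) = z) b zs" "length zs = 8"
  shows False
proof -
  have col: "collinear H" and n: "length vs \<le> 2"
    using flat_hull_few_corners[OF compact_H convex_H flat corners] by auto
  have no: False
    if s: "{a, b, c} \<subseteq> set xs" "\<nu> (p a) = z" "\<nu> (p b) \<noteq> z" "\<nu> (p c) = z"
      "\<tau> a \<le> \<tau> b" "\<tau> b \<le> \<tau> c" "\<lfloor>\<tau> a\<rfloor> = \<lfloor>\<tau> c\<rfloor>" for a b c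
  proof -
    have "p b = p a \<or> p b = p c"
    proof (rule collinear_closest_site_between[where z = z and w = "\<nu> (p b)"])
      show "p b \<in> closed_segment (p a) (p c)" using same_edge_between s by blast
      show "collinear {p a, p b, z, \<nu> (p b)}"
        using col collinear_subset source_in_hull s(1) sites \<nu>(1) by (smt (verit) empty_subsetI insert_subset subsetD)
    qed (use \<nu> s sites in \<open>metis\<close>)+
    \<comment> \<open>\<nu> depends on the position only, so \<open>b\<close> would have the site of
      \<open>a\<close> or of \<open>c\<close>, which is \<open>z\<close>.\<close>
    then show False using s by auto
  qed
  obtain j where j: "subseq (rotate j zs) xs"
    using cyclic_subseq_rotate[OF zs(1), of 0] by auto
  obtain b' where b': "alternating (\<lambda>s. \<nu> (p s) = z) b' (rotate j zs)"
    using alternating_rotate[OF zs(2)] zs(3) by auto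
  define rs where "rs = rotate j zs"
  have "length rs = 8" using zs(3) by (simp add: rs_def)
  then obtain s0 s1 s2 s3 s4 s5 s6 s7 where "rs = [s0, s1, s2, s3, s4, s5, s6, s7]"
    by (auto simp: numeral_eq_Suc length_Suc_conv)
  then have r: "rotate j zs = [s0, s1, s2, s3, s4, s5, s6, s7]" by (simp add: rs_def)
  have sub: "{s0, s1, s2, s3, s4, s5, s6, s7} \<subseteq> set xs" using subseq_sorted(2)[OF j] r by simp
  have so: "\<tau> s0 \<le> \<tau> s1" "\<tau> s1 \<le> \<tau> s2" "\<tau> s2 \<le> \<tau> s3" "\<tau> s3 \<le> \<tau> s4" "\<tau> s4 \<le> \<tau> s5" "\<tau> s5 \<le> \<tau> s6" "\<tau> s6 \<le> \<tau> s7"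
    using subseq_sorted(1)[OF j] r by auto
  have range: "0 \<le> \<tau> s" "\<tau> s < 2" if "s \<in> set xs" for s
    using \<tau>_range[OF that] n by (auto intro: less_le_trans)
  have fl0: "\<lfloor>\<tau> s\<rfloor> = 0" if "s \<in> set xs" "\<tau> s < 1" for s
    using range[OF that(1)] that(2) by (simp add: floor_eq_iff)
  have fl1: "\<lfloor>\<tau> s\<rfloor> = 1" if "s \<in> set xs" "1 \<le> \<tau> s" for s
    using range[OF that(1)] that(2) by (simp add: floor_eq_iff)
  have alt: "(\<nu> (p s0) = z) = b'" "(\<nu> (p s1) = z) = (\<not> b')" "(\<nu> (p s2) = z) = b'" "(\<nu> (p s3) = z) = (\<not> b')"
    "(\<nu> (p s4) = z) = b'" "(\<nu> (p s5) = z) = (\<not> b')" "(\<nu> (p s6) = z) = b'" "(\<nu> (p s7) = z) = (\<not> b')"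
    using b' r by simp_all
  \<comment> \<open>Times before 1 belong to the first edge, the others to the second;
    \<open>s3\<close> decides whether the first or the last four sources share an edge.\<close>
  show False
  proof (cases "\<tau> s3 < 1")
    case True
    then have "\<lfloor>\<tau> s0\<rfloor> = \<lfloor>\<tau> s2\<rfloor>" "\<lfloor>\<tau> s1\<rfloor> = \<lfloor>\<tau> s3\<rfloor>" using fl0 so sub by auto
    then show False
      using no[of s0 s1 s2] no[of s1 s2 s3] alt so sub by (cases b') auto
  next
    case False
    then have "\<lfloor>\<tau> s4\<rfloor> = \<lfloor>\<tau> s6\<rfloor>" "\<lfloor>\<tau> s5\<rfloor> = \<lfloor>\<tau> s7\<rfloor>" using fl1 so sub by auto
    then show False
      using no[of s4 s5 s6] no[of s5 s6 s7] alt so sub by (cases b') auto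
  qed
qed

lemma at_most_three_cyclic_runs:
  assumes sites: "Z \<subseteq> H" "z \<in> Z"
    and \<nu>: "\<And>x. \<nu> x \<in> Z" "\<And>x w. w \<in> Z \<Longrightarrow> dist x (\<nu> x) \<le> dist x w"
    and a: "a \<in> set xs" "\<And>w. w \<in> Z \<Longrightarrow> w \<noteq> z \<Longrightarrow> dist (p a) z < dist (p a) w"
    and zs: "cyclic_subseq zs xs" "alternating (\<lambda>s. \<nu> (p s) = z) b zs" "length zs = 8"
  shows False
proof (cases "interior H = {}")
  case True
  then show False using flat_no_alternation[OF True sites \<nu> zs] by blast
next
  case int: False
  have Qa: "\<nu> (p a) = z"
    using a(2)[OF \<nu>(1)[of "p a"]] \<nu>(2)[OF sites(2), of "p a"] by fastforce
  \<comment> \<open>The alternating cycle, of length \<open>2 * Suc 3\<close>, is made to pass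
    through the source that is strictly closest to \<open>z\<close>.\<close>
  obtain zs' where zs': "cyclic_subseq (a # zs') xs" "alternating (\<lambda>s. \<nu> (p s) = z) True (a # zs')"
    "length (a # zs') = 8"
    using alternating_cyclic_subseq_through[OF zs(1,2) _ a(1) Qa, of 3] zs(3) by auto
  obtain b1 a2 b2 a3 b3 a4 b4 where r: "zs' = [b1, a2, b2, a3, b3, a4, b4]"
    using zs'(3) by (auto simp: numeral_eq_Suc length_Suc_conv)
  have alt: "\<nu> (p b1) \<noteq> z" "\<nu> (p a2) = z" "\<nu> (p b2) \<noteq> z" "\<nu> (p a3) = z" "\<nu> (p b3) \<noteq> z"
    "\<nu> (p a4) = z" "\<nu> (p b4) \<noteq> z"
    using zs'(2) by (auto simp: r)
  define u where "u b = \<nu> (p b) - z" for b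
  have cyc: "cyclic_subseq [a, s, s', s''] xs"
    if "subseq [s, s', s''] [b1, a2, b2, a3, b3, a4, b4]" for s s' s''
    using cyclic_subseq_mono[OF zs'(1), of "[a, s, s', s'']"] that by (simp add: r)
  \<comment> \<open>\<open>a\<close> and \<open>s'\<close> separate \<open>s\<close> from
    \<open>s''\<close>; strictness at \<open>a\<close> leaves \<open>s'\<close> as the only possible
    midpoint.\<close>
  have obt: "u s \<bullet> u s'' \<le> 0" "u s \<bullet> u s'' = 0 \<longrightarrow> 2 *\<^sub>R (p s' - z) = u s + u s''"
    if "subseq [s, s', s''] [b1, a2, b2, a3, b3, a4, b4]" "\<nu> (p s) \<noteq> z" "\<nu> (p s') = z" "\<nu> (p s'') \<noteq> z" for s s' s''
  proof -
    have H: "z \<in> H" "\<nu> (p s) \<in> H" "\<nu> (p s'') \<in> H" using sites \<nu>(1) by auto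
    have neq: "z \<noteq> \<nu> (p s)" "z \<noteq> \<nu> (p s'')" using that by auto
    have disj: "{p a, p s'} \<inter> {p s, p s''} = {}" using that Qa by auto
    have near: "dist (p c) z \<le> dist (p c) v" if "\<nu> (p c) = z" "v \<in> {\<nu> (p s), \<nu> (p s'')}" for c v
      using \<nu>(2)[of v "p c"] \<nu>(1) that by auto
    note * = alternating_sites_obtuse[OF int H neq cyc[OF that(1)] disj near[OF Qa] near[OF that(3)]
        \<nu>(2)[OF sites(2)] \<nu>(2)[OF sites(2)]]
    show "u s \<bullet> u s'' \<le> 0" using *(1) by (simp add: u_def)
    have "dist (p a) z < dist (p a) (\<nu> (p s))" using a(2) \<nu>(1) neq by auto
    then show "u s \<bullet> u s'' = 0 \<longrightarrow> 2 *\<^sub>R (p s' - z) = u s + u s''" using *(2) by (simp add: u_def)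
  qed
  \<comment> \<open>One triple for each pair of the \<open>b\<close>s; all three pairs containing
    \<open>b1\<close> use the same separator \<open>a2\<close>.\<close>
  have sub: "subseq [b1, a2, b2] [b1, a2, b2, a3, b3, a4, b4]" "subseq [b1, a2, b3] [b1, a2, b2, a3, b3, a4, b4]"
    "subseq [b1, a2, b4] [b1, a2, b2, a3, b3, a4, b4]" "subseq [b2, a3, b3] [b1, a2, b2, a3, b3, a4, b4]"
    "subseq [b2, a3, b4] [b1, a2, b2, a3, b3, a4, b4]" "subseq [b3, a4, b4] [b1, a2, b2, a3, b3, a4, b4]"
    by (auto simp: subseq_Cons' list_emb_Cons)
  have nz: "u b1 \<noteq> 0" "u b2 \<noteq> 0" "u b3 \<noteq> 0" "u b4 \<noteq> 0" using alt by (auto simp: u_def)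
  have le: "u b1 \<bullet> u b2 \<le> 0" "u b1 \<bullet> u b3 \<le> 0" "u b1 \<bullet> u b4 \<le> 0" "u b2 \<bullet> u b3 \<le> 0" "u b2 \<bullet> u b4 \<le> 0" "u b3 \<bullet> u b4 \<le> 0"
    using obt(1)[OF sub(1)] obt(1)[OF sub(2)] obt(1)[OF sub(3)] obt(1)[OF sub(4)] obt(1)[OF sub(5)] obt(1)[OF sub(6)] alt
    by auto
  have mid: "u b1 \<bullet> u b2 = 0 \<longrightarrow> 2 *\<^sub>R (p a2 - z) = u b1 + u b2" "u b1 \<bullet> u b3 = 0 \<longrightarrow> 2 *\<^sub>R (p a2 - z) = u b1 + u b3"
    "u b1 \<bullet> u b4 = 0 \<longrightarrow> 2 *\<^sub>R (p a2 - z) = u b1 + u b4"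
    using obt(2)[OF sub(1)] obt(2)[OF sub(2)] obt(2)[OF sub(3)] alt by auto
  \<comment> \<open>\<open>u b1\<close> is orthogonal to two of the others, and
    \<open>2 *\<^sub>R (p a2 - z)\<close> is the sum of \<open>u b1\<close> with either of them. So
    these two are equal, and their inner product is positive.\<close>
  have "u b2 = u b3 \<or> u b2 = u b4 \<or> u b3 = u b4"
    using four_vectors_nonpos_inner[OF nz le] mid by (metis add_left_cancel)
  then show False using le(4-6) nz by (metis inner_gt_zero_iff not_le)
qed

end

section \<open>Optimal sites and layouts\<close>

text \<open>A minimiser over the compact set \<open>H\<close> is a global one, since the projection
  to \<open>H\<close> does not increase distances to points of \<open>H\<close>.\<close>

lemma median_exists:
  fixes p :: "'s \<Rightarrow> 'a::euclidean_space"
  assumes "compact H" "convex H" "t \<in> H" "p ` A \<subseteq> H"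
  shows "\<exists>m\<in>H. \<forall>q. dist m t + (\<Sum>s\<in>A. dist (p s) m) \<le> dist q t + (\<Sum>s\<in>A. dist (p s) q)"
proof -
  define F where "F q = dist q t + (\<Sum>s\<in>A. dist (p s) q)" for q
  have "continuous_on H F" unfolding F_def by (intro continuous_intros)
  then obtain m where m: "m \<in> H" "\<forall>q\<in>H. F m \<le> F q"
    using continuous_attains_inf[of H F] assms by auto
  have "F m \<le> F q" for q
  proof -
    define c where "c = closest_point H"
    have H: "closed H" "H \<noteq> {}" using assms compact_imp_closed by auto
    have self: "c x = x" if "x \<in> H" for x using that by (simp add: c_def closest_point_self)
    have contract: "dist (c q) x \<le> dist q x" "dist x (c q) \<le> dist x q" if "x \<in> H" for x
      using closest_point_lipschitz[OF assms(2) H, of q x] self[OF that] unfolding c_def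
      by (simp_all add: dist_commute)
    have "F (c q) \<le> F q"
      unfolding F_def using contract assms(3,4) by (intro add_mono sum_mono) auto
    moreover have "c q \<in> H" unfolding c_def using H by (simp add: closest_point_in_set)
    ultimately show ?thesis using m(2) order_trans by blast
  qed
  then show ?thesis using m(1) unfolding F_def by blast
qed

text \<open>The cost for \<alpha> = 0 when the Steiner points are \<open>Z\<close> and every source
  is attached to a closest site; \<open>t\<close> is a site without an edge of its own.\<close>

definition site_cost :: "'s set \<Rightarrow> ('s \<Rightarrow> 'a::metric_space) \<Rightarrow> 'a \<Rightarrow> 'a set \<Rightarrow> real" where
  "site_cost S p t Z = (\<Sum>z\<in>Z. dist z t) + (\<Sum>s\<in>S. Min (dist (p s) ` insert t Z))"

lemma closest_site_exists:
  assumes "finite Z"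
  shows "\<exists>z\<in>insert t Z. dist x z = Min (dist x ` insert t Z)"
proof -
  have "Min (dist x ` insert t Z) \<in> dist x ` insert t Z" using assms by (intro Min_in) auto
  then show ?thesis by auto
qed

lemma site_cost_le:
  assumes "finite Z" "finite S" "\<And>s. s \<in> S \<Longrightarrow> g s \<in> insert t Z"
  shows "site_cost S p t Z \<le> (\<Sum>z\<in>Z. dist z t) + (\<Sum>s\<in>S. dist (p s) (g s))"
  unfolding site_cost_def using assms by (intro add_left_mono sum_mono Min_le) auto

text \<open>Replacing each site by a median of its sources leaves only finitely many candidates.\<close>

lemma site_cost_median_le:
  fixes p :: "'s \<Rightarrow> 'a::metric_space"
  assumes S: "finite S" and Z: "finite Z"
    and m: "\<And>A q. A \<subseteq> S \<Longrightarrow> dist (m A) t + (\<Sum>s\<in>A. dist (p s) (m A)) \<le> dist q t + (\<Sum>s\<in>A. dist (p s) q)"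
  shows "\<exists>Z' \<subseteq> m ` Pow S. site_cost S p t Z' \<le> site_cost S p t Z"
proof -
  have "\<exists>z. z \<in> insert t Z \<and> dist (p s) z = Min (dist (p s) ` insert t Z)" for s
    using closest_site_exists[OF Z] by blast
  then obtain \<nu> where \<nu>: "\<And>s. \<nu> s \<in> insert t Z" "\<And>s. dist (p s) (\<nu> s) = Min (dist (p s) ` insert t Z)"
    by metis
  define A where "A z = {s. s \<in> S \<and> \<nu> s = z}" for z
  \<comment> \<open>The group of \<open>t\<close> is given a median as well; its bound is used with
    \<open>q = t\<close>, where the connection to the sink costs 0.\<close>
  define Z' where "Z' = (\<lambda>z. m (A z)) ` (\<nu> ` S)"
  have "site_cost S p t Z' \<le> (\<Sum>z\<in>Z'. dist z t) + (\<Sum>s\<in>S. dist (p s) (m (A (\<nu> s))))"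
    using S by (intro site_cost_le) (auto simp: Z'_def)
  \<comment> \<open>Groups with the same median merge into one site, hence only an
    inequality.\<close>
  also have "(\<Sum>z\<in>Z'. dist z t) \<le> (\<Sum>z\<in>\<nu> ` S. dist (m (A z)) t)"
    unfolding Z'_def using sum_image_le[of "\<nu> ` S" "\<lambda>z. dist z t" "\<lambda>z. m (A z)"] S by (simp add: o_def)
  also have "(\<Sum>s\<in>S. dist (p s) (m (A (\<nu> s)))) = (\<Sum>z\<in>\<nu> ` S. \<Sum>s\<in>A z. dist (p s) (m (A z)))"
    unfolding sum.image_gen[OF S, of _ \<nu>] A_def by (intro sum.cong refl) auto
  also have "(\<Sum>z\<in>\<nu> ` S. dist (m (A z)) t) + \<dots> = (\<Sum>z\<in>\<nu> ` S. dist (m (A z)) t + (\<Sum>s\<in>A z. dist (p s) (m (A z))))"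
    by (simp add: sum.distrib)
  also have "\<dots> \<le> (\<Sum>z\<in>\<nu> ` S. dist z t + (\<Sum>s\<in>A z. dist (p s) z))"
    using m by (intro sum_mono) (auto simp: A_def)
  also have "\<dots> = (\<Sum>z\<in>\<nu> ` S. dist z t) + (\<Sum>z\<in>\<nu> ` S. \<Sum>s\<in>A z. dist (p s) z)"
    by (simp add: sum.distrib)
  also have "(\<Sum>z\<in>\<nu> ` S. \<Sum>s\<in>A z. dist (p s) z) = (\<Sum>s\<in>S. dist (p s) (\<nu> s))"
    unfolding sum.image_gen[OF S, of _ \<nu>] A_def by (intro sum.cong refl) auto
  also have "(\<Sum>z\<in>\<nu> ` S. dist z t) \<le> (\<Sum>z\<in>insert t Z. dist z t)"
    using \<nu>(1) Z by (intro sum_mono2) auto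
  also have "\<dots> = (\<Sum>z\<in>Z. dist z t)" using Z by (simp add: sum.insert_if)
  finally have "site_cost S p t Z' \<le> site_cost S p t Z" unfolding site_cost_def \<nu>(2) by simp
  moreover have "Z' \<subseteq> m ` Pow S" by (auto simp: Z'_def A_def)
  ultimately show ?thesis by blast
qed

text \<open>The finitely many sets of medians contain an optimum; a second minimisation, of the
  cardinality, makes every site indispensable.\<close>

lemma optimal_sites:
  fixes p :: "'s \<Rightarrow> 'a::euclidean_space"
  assumes S: "finite S" and H: "compact H" "convex H" "t \<in> H" "p ` S \<subseteq> H"
  obtains Z where "finite Z" "Z \<subseteq> H" "t \<notin> Z" "\<And>Z'. finite Z' \<Longrightarrow> site_cost S p t Z \<le> site_cost S p t Z'"
    "\<And>z. z \<in> Z \<Longrightarrow> \<exists>a\<in>S. \<forall>w\<in>insert t Z. w \<noteq> z \<longrightarrow> dist (p a) z < dist (p a) w"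
proof -
  have "\<exists>m. A \<subseteq> S \<longrightarrow> m \<in> H \<and> (\<forall>q. dist m t + (\<Sum>s\<in>A. dist (p s) m) \<le> dist q t + (\<Sum>s\<in>A. dist (p s) q))" for A
    using median_exists[OF H(1-3), of p A] H(4) by blast
  then obtain m where m: "\<And>A. A \<subseteq> S \<Longrightarrow> m A \<in> H"
    "\<And>A q. A \<subseteq> S \<Longrightarrow> dist (m A) t + (\<Sum>s\<in>A. dist (p s) (m A)) \<le> dist q t + (\<Sum>s\<in>A. dist (p s) q)"
    by metis
  define opt where "opt Z \<longleftrightarrow> finite Z \<and> Z \<subseteq> H \<and> (\<forall>Z'. finite Z' \<longrightarrow> site_cost S p t Z \<le> site_cost S p t Z')" for Z
  define \<F> where "\<F> = Pow (m ` Pow S)"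
  have fin: "finite \<F>" "\<F> \<noteq> {}" using S by (auto simp: \<F>_def)
  obtain Z0 where Z0: "Z0 \<in> \<F>" "\<And>Z. Z \<in> \<F> \<Longrightarrow> site_cost S p t Z0 \<le> site_cost S p t Z"
    using ex_is_arg_min_if_finite[OF fin, of "site_cost S p t"] by (auto simp: is_arg_min_linorder)
  have "opt Z0"
    unfolding opt_def
  proof (intro conjI allI impI)
    show "finite Z0" using Z0(1) S finite_subset[of Z0 "m ` Pow S"] by (simp add: \<F>_def)
    show "Z0 \<subseteq> H" using Z0(1) m(1) by (auto simp: \<F>_def)
    fix Z' :: "'a set" assume "finite Z'"
    then obtain Z'' where "Z'' \<subseteq> m ` Pow S" "site_cost S p t Z'' \<le> site_cost S p t Z'"
      using site_cost_median_le[OF S _ m(2)] by blast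
    then show "site_cost S p t Z0 \<le> site_cost S p t Z'" using Z0(2)[of Z''] by (simp add: \<F>_def)
  qed
  then obtain Z where Z: "opt Z" "\<And>Z'. opt Z' \<Longrightarrow> card Z \<le> card Z'"
    using ex_has_least_nat[of opt Z0 card] by blast
  have finZ: "finite Z" and ZH: "Z \<subseteq> H" and best: "\<And>Z'. finite Z' \<Longrightarrow> site_cost S p t Z \<le> site_cost S p t Z'"
    using Z(1) by (auto simp: opt_def)
  have needed: "site_cost S p t Z < site_cost S p t (Z - {z})" if z: "z \<in> Z" for z
  proof (rule ccontr)
    assume "\<not> ?thesis"
    then have "opt (Z - {z})" using finZ ZH best unfolding opt_def by (meson Diff_subset finite_Diff not_le order_trans)
    then show False using Z(2) card_Diff1_less[OF finZ z] by fastforce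
  qed
  have drop: "(\<Sum>x\<in>Z - {z}. dist x t) \<le> (\<Sum>x\<in>Z. dist x t)" for z
    using finZ by (intro sum_mono2) auto
  have "t \<notin> Z"
  proof
    assume t: "t \<in> Z"
    then have "insert t (Z - {t}) = insert t Z" by auto
    then have "site_cost S p t (Z - {t}) \<le> site_cost S p t Z" unfolding site_cost_def using drop[of t] by simp
    then show False using needed[OF t] by simp
  qed
  moreover have "\<exists>a\<in>S. \<forall>w\<in>insert t Z. w \<noteq> z \<longrightarrow> dist (p a) z < dist (p a) w" if z: "z \<in> Z" for z
  proof (rule ccontr)
    assume "\<not> ?thesis"
    then have alt: "\<exists>w\<in>insert t Z. w \<noteq> z \<and> dist (p a) w \<le> dist (p a) z" if "a \<in> S" for a
      using that by (auto simp: not_less)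
    have "\<exists>w\<in>insert t (Z - {z}). dist (p a) w \<le> Min (dist (p a) ` insert t Z)" if a: "a \<in> S" for a
    proof -
      obtain w0 where w0: "w0 \<in> insert t Z" "dist (p a) w0 = Min (dist (p a) ` insert t Z)"
        using closest_site_exists[OF finZ] by blast
      obtain w where w: "w \<in> insert t Z" "w \<noteq> z" "dist (p a) w \<le> dist (p a) z" using alt[OF a] by blast
      show ?thesis
      proof (cases "w0 = z")
        case True
        then show ?thesis using w w0 by (intro bexI[of _ w]) auto
      next
        case False
        then show ?thesis using w0 by (intro bexI[of _ w0]) auto
      qed
    qed
    then obtain g where g: "\<And>a. a \<in> S \<Longrightarrow> g a \<in> insert t (Z - {z}) \<and> dist (p a) (g a) \<le> Min (dist (p a) ` insert t Z)"
      by metis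
    have "site_cost S p t (Z - {z}) \<le> (\<Sum>x\<in>Z - {z}. dist x t) + (\<Sum>s\<in>S. dist (p s) (g s))"
      using g finZ S by (intro site_cost_le) auto
    also have "\<dots> \<le> site_cost S p t Z"
      unfolding site_cost_def using g by (intro add_mono drop sum_mono) auto
    finally show False using needed[OF z] by simp
  qed
  ultimately show ?thesis using that[OF finZ ZH _ best] by blast
qed

text \<open>
  \<open>load I L u powr 0\<close> would be \<open>0\<close> rather than \<open>1\<close> on an edge without sources below it, so the
  lower bound needs every edge to carry a source.
\<close>

lemma layout_cost_ge_site_cost:
  fixes I :: "('s, 't) flamecast"
  assumes I: "finite (sources I)" "sinks I = {t}" "layers I = 1" "alpha I = 0" and L: "is_layout I L"
  shows "\<exists>Z. finite Z \<and> site_cost (sources I) (source_pos I) (sink_pos I t) Z \<le> layout_cost I L"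
proof -
  define V E S where "V = verts L" and "E = edges L" and "S = sources I"
  have forest: "finite V" "E \<subseteq> V \<times> V" "single_valued E"
    and height: "E ^^ 3 = {}"
    and leaves: "V - Range E = Source ` S"
    and roots: "V - Domain E \<subseteq> {Sink t}"
    and pos: "\<And>s. s \<in> S \<Longrightarrow> pos L (Source s) = source_pos I s" "pos L (Sink t) = sink_pos I t"
    using L I unfolding is_layout_def rooted_forest_def height_at_most_def leaves_def roots_def V_def E_def S_def
    by (simp_all add: numeral_3_eq_3)
  have inner: "V - (V - Range E) - (V - Domain E) \<subseteq> range Steiner"
    using L unfolding is_layout_def leaves_def roots_def V_def E_def by (elim conjE)
  have finE: "finite E" using forest finite_subset by blast
  \<comment> \<open>With one intermediate layer no path has three edges; this fixes the shape of the
    layout.\<close>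
  have no3: False if "(x1, x2) \<in> E" "(x2, x3) \<in> E" "(x3, x4) \<in> E" for x1 x2 x3 x4
  proof -
    have "(x1, x4) \<in> E ^^ 3" using that by (auto simp: numeral_3_eq_3)
    then show False using height by simp
  qed
  have target: "v = Sink t \<or> v \<in> V \<inter> range Steiner" if "(u, v) \<in> E" for u v
  proof -
    have "v \<in> V" "v \<notin> V - Range E" using that forest(2) by auto
    then show ?thesis using roots inner by blast
  qed
  have steiner: "\<exists>y. (y, u) \<in> E" "(u, Sink t) \<in> E" if u: "u \<in> V \<inter> range Steiner" for u
  proof -
    have "u \<notin> V - Range E" using u leaves by auto
    then show ex: "\<exists>y. (y, u) \<in> E" using u by auto
    have "u \<notin> V - Domain E" using u roots by auto
    then obtain v where v: "(u, v) \<in> E" using u by auto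
    \<comment> \<open>A Steiner parent \<open>v\<close> would have a parent itself, which gives a
      path of three edges starting at a child of \<open>u\<close>.\<close>
    have "v = Sink t"
    proof (rule ccontr)
      assume "v \<noteq> Sink t"
      then have "v \<in> V \<inter> range Steiner" using target[OF v] by blast
      then have "v \<notin> V - Domain E" "v \<in> V" using roots by auto
      then show False using ex v no3 by blast
    qed
    then show "(u, Sink t) \<in> E" using v by simp
  qed
  have source: "\<exists>v. (Source s, v) \<in> E" if "s \<in> S" for s
  proof -
    have "Source s \<in> V" "Source s \<notin> V - Domain E" using that leaves roots by auto
    then show ?thesis by auto
  qed
  then obtain par where par: "\<And>s. s \<in> S \<Longrightarrow> (Source s, par s) \<in> E" by metis
  have load: "load I L u \<noteq> 0" if uv: "(u, v) \<in> E" for u v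
  proof -
    have "\<exists>s\<in>S. (Source s, u) \<in> E\<^sup>*"
    proof (cases "u \<in> V - Range E")
      case True
      then show ?thesis using leaves by auto
    next
      case False
      then obtain y where y: "(y, u) \<in> E" using uv forest(2) by auto
      \<comment> \<open>An edge into \<open>y\<close> would start a path of three edges, so
        \<open>y\<close> is a leaf and thus a source.\<close>
      have "y \<in> V - Range E" using y uv no3 forest(2) by blast
      then show ?thesis using leaves y by auto
    qed
    then show ?thesis using I(1) by (auto simp: load_def E_def S_def card_eq_0_iff)
  qed
  define d where "d = (\<lambda>(u, v). dist (pos L u) (pos L v))"
  have cost: "layout_cost I L = (\<Sum>e\<in>E. d e)"
    unfolding layout_cost_def d_def E_def[symmetric] using I(4)
    by (intro sum.cong) (auto simp: dist_norm dest: load)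
  define St where "St = V \<inter> range Steiner"
  have finSt: "finite St" using forest(1) by (simp add: St_def)
  have "site_cost S (source_pos I) (sink_pos I t) (pos L ` St)
      \<le> (\<Sum>z\<in>pos L ` St. dist z (sink_pos I t)) + (\<Sum>s\<in>S. dist (source_pos I s) (pos L (par s)))"
  proof (rule site_cost_le)
    show "pos L (par s) \<in> insert (sink_pos I t) (pos L ` St)" if "s \<in> S" for s
      using target[OF par[OF that]] pos(2) by (auto simp: St_def)
  qed (use finSt I(1) in \<open>auto simp: S_def\<close>)
  \<comment> \<open>Several Steiner vertices may share a position; passing to the set of positions
    can only lower the sum.\<close>
  also have "(\<Sum>z\<in>pos L ` St. dist z (sink_pos I t)) \<le> (\<Sum>u\<in>St. dist (pos L u) (sink_pos I t))"
    using sum_image_le[OF finSt, of "\<lambda>z. dist z (sink_pos I t)" "pos L"] by (simp add: o_def)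
  also have "\<dots> = (\<Sum>e\<in>(\<lambda>u. (u, Sink t)) ` St. d e)"
    by (subst sum.reindex) (auto simp: inj_on_def d_def pos)
  also have "(\<Sum>s\<in>S. dist (source_pos I s) (pos L (par s))) = (\<Sum>e\<in>(\<lambda>s. (Source s, par s)) ` S. d e)"
    by (subst sum.reindex) (auto simp: inj_on_def d_def pos)
  also have "(\<Sum>e\<in>(\<lambda>u. (u, Sink t)) ` St. d e) + (\<Sum>e\<in>(\<lambda>s. (Source s, par s)) ` S. d e)
      = (\<Sum>e\<in>(\<lambda>u. (u, Sink t)) ` St \<union> (\<lambda>s. (Source s, par s)) ` S. d e)"
    using finSt I(1) by (intro sum.union_disjoint[symmetric]) (auto simp: St_def S_def)
  also have "\<dots> \<le> (\<Sum>e\<in>E. d e)"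
    using finE par steiner(2) by (intro sum_mono2) (auto simp: St_def d_def)
  finally show ?thesis using cost finSt unfolding S_def by (intro exI[of _ "pos L ` St"]) simp
qed

text \<open>Conversely, sites become Steiner vertices numbered by \<open>idx\<close>. Each must
  serve a source, since otherwise its vertex would be a leaf.\<close>

lemma layout_of_sites:
  fixes I :: "('s, 't) flamecast" and t :: 't and \<nu> :: "'s \<Rightarrow> real^2"
  assumes I: "finite (sources I)" "sinks I = {t}" "layers I = 1" "alpha I = 0"
    and Z: "finite Z" "sink_pos I t \<notin> Z" "\<And>z. z \<in> Z \<Longrightarrow> \<exists>s\<in>sources I. \<nu> s = z"
    and \<nu>: "\<And>s. s \<in> sources I \<Longrightarrow> \<nu> s \<in> insert (sink_pos I t) Z"
  obtains L where "is_layout I L"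
    "layout_cost I L \<le> (\<Sum>z\<in>Z. dist z (sink_pos I t)) + (\<Sum>s\<in>sources I. dist (source_pos I s) (\<nu> s))"
    "\<And>v. v \<in> verts L \<inter> range Steiner \<Longrightarrow> \<exists>z\<in>Z. children L v = Source ` {s \<in> sources I. \<nu> s = z}"
proof -
  define S where "S = sources I"
  define q where "q = sink_pos I t"
  obtain idx :: "real^2 \<Rightarrow> nat" where idx: "inj_on idx Z"
    using finite_imp_inj_to_nat_seg[OF Z(1)] by blast
  define site :: "real^2 \<Rightarrow> ('s, 't) vertex" where "site z = (if z = q then Sink t else Steiner (idx z))" for z
  define E1 where "E1 = (\<lambda>s. (Source s :: ('s, 't) vertex, site (\<nu> s))) ` S"
  define E2 where "E2 = (\<lambda>z. (Steiner (idx z) :: ('s, 't) vertex, Sink t :: ('s, 't) vertex)) ` Z"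
  \<comment> \<open>Without sources the sink is left out: as an isolated vertex it would be a
    leaf.\<close>
  define L :: "('s, 't) layout" where "L = \<lparr>
     verts = Source ` S \<union> (Steiner \<circ> idx) ` Z \<union> (if S = {} then {} else {Sink t}),
     edges = E1 \<union> E2,
     pos = (\<lambda>v. case v of Source s \<Rightarrow> source_pos I s | Sink t' \<Rightarrow> sink_pos I t' | Steiner i \<Rightarrow> inv_into Z idx i)\<rparr>"
  have S: "finite S" using I(1) by (simp add: S_def)
  have used: "\<exists>s\<in>S. \<nu> s = z" if "z \<in> Z" for z using Z(3) that by (simp add: S_def)
  have \<nu>S: "\<nu> s = q \<or> \<nu> s \<in> Z" if "s \<in> S" for s using \<nu> that by (auto simp: S_def q_def)
  have qZ: "z \<noteq> q" if "z \<in> Z" for z using Z(2) that by (auto simp: q_def)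
  have site_pos: "pos L (site z) = z" if "z \<in> insert q Z" for z
    using that idx by (auto simp: L_def site_def q_def)
  have V: "verts L = Source ` S \<union> (Steiner \<circ> idx) ` Z \<union> (if S = {} then {} else {Sink t})"
    and E: "edges L = E1 \<union> E2" by (simp_all add: L_def)
  have E_cases: "(\<exists>s\<in>S. u = Source s \<and> v = Sink t) \<or> (\<exists>s\<in>S. \<exists>z\<in>Z. u = Source s \<and> v = Steiner (idx z))
      \<or> (\<exists>z\<in>Z. u = Steiner (idx z) \<and> v = Sink t)" if "(u, v) \<in> edges L" for u v
  proof (cases "(u, v) \<in> E1")
    case True
    then obtain s where "s \<in> S" "u = Source s" "v = site (\<nu> s)" by (auto simp: E1_def)
    then show ?thesis using \<nu>S[of s] by (auto simp: site_def)
  next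
    case False
    then show ?thesis using that unfolding E E2_def by auto
  qed
  have Zne: "S \<noteq> {}" if "z \<in> Z" for z using used[OF that] by auto
  have sub: "edges L \<subseteq> verts L \<times> verts L"
  proof
    fix e assume "e \<in> edges L"
    then show "e \<in> verts L \<times> verts L"
      using E_cases[of "fst e" "snd e"] Zne unfolding V by (cases e) auto
  qed
  have sv: "single_valued (edges L)"
    unfolding single_valued_def E E1_def E2_def by auto
  \<comment> \<open>Every edge increases the rank, which is at most 2; this yields both acyclicity
    and the height bound.\<close>
  define rank :: "('s, 't) vertex \<Rightarrow> nat" where
    "rank v = (case v of Source s \<Rightarrow> 0 | Steiner i \<Rightarrow> 1 | Sink t' \<Rightarrow> 2)" for v
  have rank: "rank u < rank v" if "(u, v) \<in> edges L" for u v
    using E_cases[OF that] by (auto simp: rank_def)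
  have rank_pow: "rank u + n \<le> rank v" if "(u, v) \<in> edges L ^^ n" for u v n
    using that
  proof (induction n arbitrary: v)
    case (Suc n)
    then obtain w where "(u, w) \<in> edges L ^^ n" "(w, v) \<in> edges L" by auto
    then show ?case using Suc.IH[of w] rank[of w v] by simp
  qed simp
  have acy: "acyclic (edges L)"
  proof (rule acyclicI, intro allI)
    fix x show "(x, x) \<notin> (edges L)\<^sup>+"
    proof
      assume "(x, x) \<in> (edges L)\<^sup>+"
      then obtain n where "n > 0" "(x, x) \<in> edges L ^^ n" using trancl_power by blast
      then show False using rank_pow by fastforce
    qed
  qed
  have height: "edges L ^^ Suc (layers I + 1) = {}"
  proof (rule ccontr)
    assume "\<not> ?thesis"
    then obtain u v where "(u, v) \<in> edges L ^^ Suc (layers I + 1)" by auto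
    then have "rank u + Suc (layers I + 1) \<le> rank v" by (rule rank_pow)
    moreover have "rank v \<le> 2" by (auto simp: rank_def split: vertex.split)
    ultimately show False using I(3) by simp
  qed
  have src: "Source s \<in> Domain (edges L)" "Source s \<notin> Range (edges L)" if "s \<in> S" for s
  proof -
    show "Source s \<in> Domain (edges L)" using that unfolding E E1_def by auto
    show "Source s \<notin> Range (edges L)" using E_cases by blast
  qed
  have stn: "Steiner (idx z) \<in> Domain (edges L)" "Steiner (idx z) \<in> Range (edges L)" if z: "z \<in> Z" for z
  proof -
    show "Steiner (idx z) \<in> Domain (edges L)" using z unfolding E E2_def by auto
    obtain s where "s \<in> S" "\<nu> s = z" using used[OF z] by blast
    then have "(Source s, Steiner (idx z)) \<in> E1" using qZ[OF z] by (auto simp: E1_def site_def)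
    then show "Steiner (idx z) \<in> Range (edges L)" unfolding E by auto
  qed
  have snk: "Sink t \<notin> Domain (edges L)" "S \<noteq> {} \<Longrightarrow> Sink t \<in> Range (edges L)"
  proof -
    show "Sink t \<notin> Domain (edges L)" using E_cases by blast
    assume "S \<noteq> {}"
    then obtain s where s: "s \<in> S" by blast
    show "Sink t \<in> Range (edges L)"
    proof (cases "\<nu> s = q")
      case True
      then have "(Source s, Sink t) \<in> E1" using s by (auto simp: E1_def site_def)
      then show ?thesis unfolding E by auto
    next
      case False
      then have "(Steiner (idx (\<nu> s)), Sink t) \<in> E2" using \<nu>S[OF s] by (auto simp: E2_def)
      then show ?thesis unfolding E by auto
    qed
  qed
  have lv: "leaves (verts L) (edges L) = Source ` S"
    unfolding leaves_def V using src stn snk by auto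
  have rt: "roots (verts L) (edges L) \<subseteq> {Sink t}"
    unfolding roots_def V using src stn by auto
  have layout: "is_layout I L"
    unfolding is_layout_def
  proof (intro conjI)
    show "rooted_forest (verts L) (edges L)"
      unfolding rooted_forest_def using sub sv acy S Z(1) by (simp add: V)
    show "height_at_most (layers I + 1) (edges L)" unfolding height_at_most_def by (rule height)
    show "leaves (verts L) (edges L) = Source ` sources I" using lv by (simp add: S_def)
    show "roots (verts L) (edges L) \<subseteq> Sink ` sinks I" using rt I(2) by auto
    show "verts L - leaves (verts L) (edges L) - roots (verts L) (edges L) \<subseteq> range Steiner"
      unfolding lv roots_def using snk(1) by (auto simp: V split: if_splits)
  qed (auto simp: L_def)
  define d where "d = (\<lambda>(u, v). dist (pos L u) (pos L v))"
  have "layout_cost I L \<le> (\<Sum>e\<in>edges L. d e)"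
    unfolding layout_cost_def
  proof (rule sum_mono)
    fix e assume "e \<in> edges L"
    obtain u v where e: "e = (u, v)" by force
    \<comment> \<open>For exponent 0 the power is 0 or 1, and an upper bound is enough here.\<close>
    have "real (load I L u) powr alpha I \<le> 1" using I(4) by (simp add: powr_def)
    then show "(case e of (u, v) \<Rightarrow> norm (pos L u - pos L v) * real (load I L u) powr alpha I) \<le> d e"
      unfolding e d_def by (simp add: dist_norm mult_left_le)
  qed
  also have "\<dots> \<le> (\<Sum>e\<in>E1. d e) + (\<Sum>e\<in>E2. d e)"
    unfolding E using S Z(1) by (subst sum.union_inter[symmetric]) (auto simp: E1_def E2_def d_def intro!: sum_nonneg)
  also have "(\<Sum>e\<in>E1. d e) = (\<Sum>s\<in>S. dist (source_pos I s) (\<nu> s))"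
    unfolding E1_def using \<nu>S site_pos
    by (subst sum.reindex) (auto simp: inj_on_def d_def L_def intro!: sum.cong)
  also have "(\<Sum>e\<in>E2. d e) = (\<Sum>z\<in>Z. dist z q)"
    unfolding E2_def using idx
    by (subst sum.reindex) (auto simp: inj_on_def d_def L_def q_def intro!: sum.cong)
  finally have cost: "layout_cost I L \<le> (\<Sum>z\<in>Z. dist z (sink_pos I t)) + (\<Sum>s\<in>sources I. dist (source_pos I s) (\<nu> s))"
    by (simp add: S_def q_def)
  have "\<exists>z\<in>Z. children L v = Source ` {s \<in> sources I. \<nu> s = z}" if v: "v \<in> verts L \<inter> range Steiner" for v
  proof -
    obtain z where z: "z \<in> Z" "v = Steiner (idx z)" using v unfolding V by (auto split: if_splits)
    have eq: "site (\<nu> s) = v \<longleftrightarrow> \<nu> s = z" if "s \<in> S" for s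
      using \<nu>S[OF that] z qZ idx by (auto simp: site_def inj_on_def)
    have "v \<noteq> Sink t" using z(2) by simp
    then have "(u, v) \<in> edges L \<longleftrightarrow> (\<exists>s\<in>S. u = Source s \<and> site (\<nu> s) = v)" for u
      unfolding E E1_def E2_def by auto
    then have "children L v = Source ` {s \<in> S. \<nu> s = z}"
      unfolding children_def using eq by auto
    then show ?thesis using z(1) by (auto simp: S_def)
  qed
  then show ?thesis using that[OF layout cost] by blast
qed

theorem corollary31:
  fixes I :: "('s, 't) flamecast" and t :: 't and xs :: "'s list"
  assumes "flamecast I"
    and "sinks I = {t}"
    and "layers I = 1"
    and "alpha I = 0"
    and "convex_instance I"
    and "ccw_source_order I xs"
  shows "\<exists>k L. min_cost_layout I L \<and> layout_consecutive 3 (rotate k xs) L"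
proof -
  define S p q H where "S = sources I" and "p = source_pos I" and "q = sink_pos I t" and "H = instance_hull I"
  have finS: "finite S" using assms(1) by (simp add: flamecast_def S_def)
  have H: "H = convex hull (p ` S \<union> {q})" by (simp add: H_def instance_hull_def S_def p_def q_def assms(2))
  have compact: "compact H" unfolding H using finS by (intro finite_imp_compact_convex_hull) simp
  have convex: "convex H" by (simp add: H)
  have inH: "q \<in> H" "p ` S \<subseteq> H" unfolding H using hull_subset[of "p ` S \<union> {q}" convex] by auto
  obtain vs \<tau> where order: "distinct xs" "set xs = S" "ccw_corners H vs" "sorted (map \<tau> xs)"
    "\<And>s. s \<in> S \<Longrightarrow> \<tau> s \<in> {0..<real (length vs)}" "\<And>s. s \<in> S \<Longrightarrow> boundary_walk vs (\<tau> s) = p s"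
    using assms(6) unfolding ccw_source_order_def S_def H_def p_def by blast
  interpret sources_on_boundary H vs xs p \<tau>
    using compact convex order by unfold_locales auto
  obtain Z where Z: "finite Z" "Z \<subseteq> H" "q \<notin> Z"
    and best: "\<And>Z'. finite Z' \<Longrightarrow> site_cost S p q Z \<le> site_cost S p q Z'"
    and strict: "\<And>z. z \<in> Z \<Longrightarrow> \<exists>a\<in>S. \<forall>w\<in>insert q Z. w \<noteq> z \<longrightarrow> dist (p a) z < dist (p a) w"
    using optimal_sites[OF finS compact convex inH] by metis
  have "\<exists>z. z \<in> insert q Z \<and> dist x z = Min (dist x ` insert q Z)" for x
    using closest_site_exists[OF Z(1)] by blast
  \<comment> \<open>\<nu> is chosen per position, so coincident sources get the same site and
    sources of different groups have different positions.\<close>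
  then obtain \<nu> where \<nu>: "\<And>x. \<nu> x \<in> insert q Z" "\<And>x. dist x (\<nu> x) = Min (dist x ` insert q Z)"
    by metis
  have near: "dist x (\<nu> x) \<le> dist x w" if "w \<in> insert q Z" for x w
    unfolding \<nu>(2) using that Z(1) by (intro Min_le) auto
  \<comment> \<open>The source strictly closest to \<open>z\<close> cannot be attached elsewhere, so
    every Steiner vertex gets a child.\<close>
  have used: "\<exists>s\<in>S. \<nu> (p s) = z" if "z \<in> Z" for z
  proof -
    obtain a where "a \<in> S" "\<forall>w\<in>insert q Z. w \<noteq> z \<longrightarrow> dist (p a) z < dist (p a) w" using strict \<open>z \<in> Z\<close> by blast
    moreover have "\<not> dist (p a) z < dist (p a) (\<nu> (p a))" using near[of z "p a"] \<open>z \<in> Z\<close> by simp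
    ultimately show ?thesis using \<nu>(1) by blast
  qed
  obtain L where L: "is_layout I L"
    and cost: "layout_cost I L \<le> (\<Sum>z\<in>Z. dist z q) + (\<Sum>s\<in>S. dist (p s) (\<nu> (p s)))"
    and children: "\<And>v. v \<in> verts L \<inter> range Steiner \<Longrightarrow> \<exists>z\<in>Z. children L v = Source ` {s \<in> S. \<nu> (p s) = z}"
    using layout_of_sites[of I t Z "\<lambda>s. \<nu> (p s)"] finS assms(2-4) Z used \<nu>(1)
    unfolding S_def p_def q_def by auto
  have "min_cost_layout I L"
    unfolding min_cost_layout_def
  proof (intro conjI allI impI)
    fix L' assume "is_layout I L'"
    then obtain Z' where "finite Z'" "site_cost S p q Z' \<le> layout_cost I L'"
      using layout_cost_ge_site_cost[of I t L'] finS assms(2-4) unfolding S_def p_def q_def by auto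
    moreover have "layout_cost I L \<le> site_cost S p q Z" using cost unfolding site_cost_def \<nu>(2) .
    ultimately show "layout_cost I L \<le> layout_cost I L'" using best[of Z'] by linarith
  qed (rule L)
  \<comment> \<open>If all sources share one site, the condition on \<open>k\<close> is void;
    otherwise the cut lies between two sources of different groups.\<close>
  moreover obtain k where k: "\<And>s s'. s \<in> S \<Longrightarrow> s' \<in> S \<Longrightarrow> \<nu> (p s) \<noteq> \<nu> (p s') \<Longrightarrow>
      \<nu> (p (hd (rotate k xs))) \<noteq> \<nu> (p (last (rotate k xs)))"
    using rotate_between_unequal[where f = "\<lambda>s. \<nu> (p s)" and xs = xs] order(2) by metis
  have "layout_consecutive 3 (rotate k xs) L"
    unfolding layout_consecutive_def
  proof
    fix v assume "v \<in> verts L \<inter> range Steiner"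
    then obtain z where z: "z \<in> Z" "children L v = Source ` {s \<in> S. \<nu> (p s) = z}" using children by blast
    define Q where "Q s \<longleftrightarrow> \<nu> (p s) = z" for s
    obtain a where a: "a \<in> set xs" "\<And>w. w \<in> insert q Z \<Longrightarrow> w \<noteq> z \<Longrightarrow> dist (p a) z < dist (p a) w"
      using strict[OF z(1)] order(2) by blast
    have no8: False if "cyclic_subseq zs xs" "alternating Q b zs" "length zs = 8" for zs b
      using at_most_three_cyclic_runs[of "insert q Z" z \<nu> a zs b] that a Z inH z(1) \<nu>(1) near
      unfolding Q_def by auto
    \<comment> \<open>Seven alternating sources would show four linear runs. They include sources of
      different groups, so one end of the rotated list is outside the group of \<open>z\<close>;
      this end completes an alternating cycle of eight.\<close>
    have "\<nexists>zs. length zs = Suc (2 * 3) \<and> subseq zs (rotate k xs) \<and> alternating Q True zs"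
    proof
      assume "\<exists>zs. length zs = Suc (2 * 3) \<and> subseq zs (rotate k xs) \<and> alternating Q True zs"
      then obtain zs where zs: "length zs = Suc (2 * 3)" "subseq zs (rotate k xs)" "alternating Q True zs" by blast
      then obtain x y ws where w: "zs = x # y # ws" by (auto simp: numeral_eq_Suc length_Suc_conv)
      have "set zs \<subseteq> S" using zs(2) cyclic_subseq_set order(2) unfolding cyclic_subseq_def by blast
      then have "x \<in> S" "y \<in> S" "\<nu> (p x) \<noteq> \<nu> (p y)" using zs(3) w by (auto simp: Q_def)
      then have "\<not> Q (hd (rotate k xs)) \<or> \<not> Q (last (rotate k xs))" using k[of x y] by (auto simp: Q_def)
      then obtain zs' b where "subseq zs' (rotate k xs)" "alternating Q b zs'" "length zs' = 2 * Suc 3"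
        using alternating_cyclic_closure[OF zs(2,3,1)] by blast
      then show False using no8[of zs' b] unfolding cyclic_subseq_def by auto
    qed
    then obtain P where P: "partition_on {x \<in> set (rotate k xs). Q x} P" "finite P" "card P \<le> 3"
      "\<forall>B\<in>P. \<exists>us. sublist us (rotate k xs) \<and> B = set us"
      using partition_into_runs[of "rotate k xs" 3 Q] order(1) by auto
    have ch: "children L v = Source ` {x \<in> set (rotate k xs). Q x}" using z(2) order(2) by (simp add: Q_def)
    define P' where "P' = (`) (Source :: 's \<Rightarrow> ('s, 't) vertex) ` P - {{}}"
    have "partition_on (children L v) P'"
      unfolding ch P'_def by (rule partition_on_inj_image[OF P(1)]) (simp add: inj_on_def)
    moreover have "finite P'" using P(2) by (simp add: P'_def)
    moreover have "card P' \<le> 3"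
    proof -
      have "card P' \<le> card ((`) (Source :: 's \<Rightarrow> ('s, 't) vertex) ` P)"
        unfolding P'_def using P(2) by (intro card_mono) auto
      also have "\<dots> \<le> card P" using P(2) by (rule card_image_le)
      finally show ?thesis using P(3) by simp
    qed
    moreover have "\<forall>B\<in>P'. \<exists>ys. sublist ys (rotate k xs) \<and> B = Source ` set ys"
    proof
      fix B assume "B \<in> P'"
      then obtain B0 where B0: "B0 \<in> P" "B = Source ` B0" by (auto simp: P'_def)
      then obtain us where "sublist us (rotate k xs)" "B0 = set us" using P(4) by blast
      then show "\<exists>ys. sublist ys (rotate k xs) \<and> B = Source ` set ys" using B0(2) by blast
    qed
    ultimately show "vertex_consecutive 3 (rotate k xs) L v" unfolding vertex_consecutive_def by blast
  qed
  ultimately show ?thesis by blast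
qed

end
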